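(* Let $d\ge 1$ and let $H:\mathbb{R}^d\to\mathbb{R}$ satisfy assumptions (A) (regularity, coercivity, strict convexity) and (B) (uniform directional convexity) stated in the context. Then for every time $T>0$ the map $S_T:\mathbf{Lip}(\mathbb{R}^d)\to\mathbf{Lip}(\mathbb{R}^d)$ is compact in $\mathbf{W}^{1,1}_{\mathrm{loc}}(\mathbb{R}^d)$; that is, for all $m,M>0$, the image under $S_T$ of the set $\{\bar u\in\mathbf{Lip}(\mathbb{R}^d):|\bar u(0)|\le m,\ \mathrm{Lip}[\bar u]\le M\}$ is relatively compact in $\mathbf{W}^{1,1}_{\mathrm{loc}}(\mathbb{R}^d)$.
   Context: Assumptions on $H:\mathbb{R}^d\to\mathbb{R}$: (A) $H\in\mathcal{C}^1(\mathbb{R}^d)$, $\lim_{|p|\to\infty}H(p)/|p|=+\infty$, and $H$ is strictly convex. (B) For every $r>0$, $\displaystyle\inf_{p\ne q\in\overline B(0,r)}\left\langle \frac{DH(p)-DH(q)}{|DH(p)-DH(q)|},\frac{p-q}{|p-q|}\right\rangle>0$. $\mathbf{Lip}(\mathbb{R}^d)$ is the set of Lipschitz functions $\mathbb{R}^d\to\mathbb{R}$ and $\mathrm{Lip}[f]$ is the best Lipschitz constant of $f$. With $L(q)=\max_{p\in\mathbb{R}^d}\{\langle p,q\rangle-H(p)\}$, the Hopf-Lax semigroup is $S_tu_0(x)=\min_{y\in\mathbb{R}^d}\{u_0(y)+tL((x-y)/t)\}$ for $t>0$, $u_0\in\mathbf{Lip}(\mathbb{R}^d)$ (the viscosity solution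 at time $t$ of $u_t+H(D_xu)=0$, $u(0,\cdot)=u_0$). *)

theory Defs
  imports "HOL-Analysis.Analysis"
begin

section \<open>Smooth functions\<close>

definition grad :: "('a::euclidean_space \<Rightarrow> real) \<Rightarrow> 'a \<Rightarrow> 'a" where
  "grad f x = (THE D. GDERIV f x :> D)"

primrec Ck :: "nat \<Rightarrow> ('a::euclidean_space \<Rightarrow> real) \<Rightarrow> bool" where
  "Ck 0 f \<longleftrightarrow> continuous_on UNIV f"
| "Ck (Suc k) f \<longleftrightarrow> (\<forall>x. f differentiable (at x)) \<and> (\<forall>i\<in>Basis. Ck k (\<lambda>x. grad f x \<bullet> i))"

definition test_function :: "('a::euclidean_space \<Rightarrow> real) \<Rightarrow> bool" where
  "test_function \<phi> \<longleftrightarrow> (\<forall>k. Ck k \<phi>) \<and> compact (closure {x. \<phi> x \<noteq> 0})"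

lemma grad_eqI: "GDERIV f x :> D \<Longrightarrow> grad f x = D"
  unfolding grad_def
proof (rule the_equality)
  fix E assume "GDERIV f x :> D" "GDERIV f x :> E"
  then have "(\<lambda>h. h \<bullet> D) = (\<lambda>h. h \<bullet> E)"
    unfolding gderiv_def by (rule has_derivative_unique)
  then have "(E - D) \<bullet> D = (E - D) \<bullet> E" by (rule fun_cong)
  then have "(E - D) \<bullet> (E - D) = 0" by (simp add: inner_diff_right)
  then show "E = D" by simp
qed

section \<open>The assumptions on the Hamiltonian\<close>

definition strictly_convex :: "('a::real_vector \<Rightarrow> real) \<Rightarrow> bool" where
  "strictly_convex H \<longleftrightarrow>
    (\<forall>p q t. p \<noteq> q \<and> 0 < t \<and> t < 1 \<longrightarrow>
      H ((1 - t) *\<^sub>R p + t *\<^sub>R q) < (1 - t) * H p + t * H q)"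

definition assumption_A :: "('a::euclidean_space \<Rightarrow> real) \<Rightarrow> bool" where
  "assumption_A H \<longleftrightarrow>
    Ck 1 H \<and> filterlim (\<lambda>p. H p / norm p) at_top at_infinity \<and> strictly_convex H"

text \<open>
  Under assumption A the gradient is injective, so neither denominator below vanishes; and the
  set over which the infimum is taken is nonempty and bounded below by \<open>-1\<close>.
\<close>

definition assumption_B :: "('a::euclidean_space \<Rightarrow> real) \<Rightarrow> bool" where
  "assumption_B H \<longleftrightarrow>
    (\<forall>r>0. 0 < (INF (p, q) \<in> {(p, q). p \<in> cball 0 r \<and> q \<in> cball 0 r \<and> p \<noteq> q}.
       ((grad H p - grad H q) /\<^sub>R norm (grad H p - grad H q)) \<bullet> ((p - q) /\<^sub>R norm (p - q))))"

section \<open>Lipschitz functions and the Hopf--Lax semigroup\<close>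

definition Lip :: "('a::euclidean_space \<Rightarrow> real) set" where
  "Lip = {u. \<exists>C. C-lipschitz_on UNIV u}"

definition lip_const :: "('a::euclidean_space \<Rightarrow> real) \<Rightarrow> real" where
  "lip_const u = Inf {C. C-lipschitz_on UNIV u}"

text \<open>
  The operators \<open>GREATEST\<close> and \<open>LEAST\<close> on the reals denote a maximum and a minimum: they are
  specified only if the extremum is attained.
\<close>

definition legendre :: "('a::euclidean_space \<Rightarrow> real) \<Rightarrow> 'a \<Rightarrow> real" where
  "legendre H q = (GREATEST v. \<exists>p. v = p \<bullet> q - H p)"

definition hopf_lax ::
    "('a::euclidean_space \<Rightarrow> real) \<Rightarrow> real \<Rightarrow> ('a \<Rightarrow> real) \<Rightarrow> 'a \<Rightarrow> real" where
  "hopf_lax H t u x = (LEAST v. \<exists>y. v = u y + t * legendre H ((x - y) /\<^sub>R t))"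

section \<open>The local Sobolev space\<close>

definition locally_integrable ::
    "('a::euclidean_space \<Rightarrow> 'b::euclidean_space) \<Rightarrow> bool" where
  "locally_integrable f \<longleftrightarrow> (\<forall>K. compact K \<longrightarrow> set_integrable lebesgue K f)"

definition weak_gradient :: "('a::euclidean_space \<Rightarrow> real) \<Rightarrow> ('a \<Rightarrow> 'a) \<Rightarrow> bool" where
  "weak_gradient f G \<longleftrightarrow> locally_integrable f \<and> locally_integrable G \<and>
    (\<forall>\<phi>. test_function \<phi> \<longrightarrow>
      (\<integral>x. f x *\<^sub>R grad \<phi> x \<partial>lebesgue) = - (\<integral>x. \<phi> x *\<^sub>R G x \<partial>lebesgue))"

definition W11_loc :: "('a::euclidean_space \<Rightarrow> real) set" where
  "W11_loc = {f. \<exists>G. weak_gradient f G}"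

text \<open>
  The open ball around \<open>f\<close> for the seminorm that integrates \<open>\<bar>u\<bar> + \<bar>Du\<bar>\<close> over \<open>K\<close>. Weak
  gradients are unique almost everywhere, so the integral does not depend on the choice of
  \<open>G\<close>.
\<close>

definition W11_ball ::
    "'a set \<Rightarrow> ('a::euclidean_space \<Rightarrow> real) \<Rightarrow> real \<Rightarrow> ('a \<Rightarrow> real) set" where
  "W11_ball K f e = {g \<in> W11_loc. \<exists>G. weak_gradient (\<lambda>x. g x - f x) G \<and>
    (LINT x:K|lebesgue. \<bar>g x - f x\<bar>) + (LINT x:K|lebesgue. norm (G x)) < e}"

text \<open>
  The points are functions rather than classes of functions modulo equality almost everywhere.
  Functions that agree almost everywhere are topologically indistinguishable, so the topology is
  not Hausdorff; its quotient by this relation is the usual Frechet space, and a set has compact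
  closure here if and only if its set of classes has compact closure there.
\<close>

definition W11_loc_topology :: "('a::euclidean_space \<Rightarrow> real) topology" where
  "W11_loc_topology = topology (\<lambda>U. U \<subseteq> W11_loc \<and>
    (\<forall>f\<in>U. \<exists>K e. compact K \<and> 0 < e \<and> W11_ball K f e \<subseteq> U))"

definition relatively_compact_in :: "'b topology \<Rightarrow> 'b set \<Rightarrow> bool" where
  "relatively_compact_in X S \<longleftrightarrow> S \<subseteq> topspace X \<and> compactin X (X closure_of S)"

lemma W11_ball_mono:
  assumes "compact K" "compact K'" "K \<subseteq> K'" "e' \<le> e"
  shows "W11_ball K' f e' \<subseteq> W11_ball K f e"
proof
  fix g assume "g \<in> W11_ball K' f e'"
  then obtain G where g: "g \<in> W11_loc" and G: "weak_gradient (\<lambda>x. g x - f x) G"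
    and lt: "(LINT x:K'|lebesgue. \<bar>g x - f x\<bar>) + (LINT x:K'|lebesgue. norm (G x)) < e'"
    by (auto simp: W11_ball_def)
  have mono: "(LINT x:K|lebesgue. norm (h x)) \<le> (LINT x:K'|lebesgue. norm (h x))"
    if "locally_integrable h" for h :: "'a \<Rightarrow> 'c::euclidean_space"
  proof -
    have int: "set_integrable lebesgue C (\<lambda>x. norm (h x))" if "compact C" for C
      using \<open>locally_integrable h\<close> that by (auto simp: locally_integrable_def intro: set_integrable_norm)
    show ?thesis
      unfolding set_lebesgue_integral_def
      using int[OF assms(1)] int[OF assms(2)] assms(3)
      by (intro integral_mono) (auto simp: set_integrable_def indicator_def)
  qed
  have "locally_integrable (\<lambda>x. g x - f x)" "locally_integrable G"
    using G by (auto simp: weak_gradient_def)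
  then have "(LINT x:K|lebesgue. \<bar>g x - f x\<bar>) + (LINT x:K|lebesgue. norm (G x)) < e"
    using mono[of "\<lambda>x. g x - f x"] mono[of G] lt assms(4) by simp
  then show "g \<in> W11_ball K f e"
    using g G by (auto simp: W11_ball_def)
qed

lemma istopology_W11_loc:
  "istopology (\<lambda>U. U \<subseteq> (W11_loc :: ('a::euclidean_space \<Rightarrow> real) set) \<and>
    (\<forall>f\<in>U. \<exists>K e. compact K \<and> 0 < e \<and> W11_ball K f e \<subseteq> U))"
  unfolding istopology_def
proof (intro conjI allI impI ballI)
  fix S T :: "('a \<Rightarrow> real) set" and f
  assume S: "S \<subseteq> W11_loc \<and> (\<forall>f\<in>S. \<exists>K e. compact K \<and> 0 < e \<and> W11_ball K f e \<subseteq> S)"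
    and T: "T \<subseteq> W11_loc \<and> (\<forall>f\<in>T. \<exists>K e. compact K \<and> 0 < e \<and> W11_ball K f e \<subseteq> T)"
    and f: "f \<in> S \<inter> T"
  obtain K e where K: "compact K" "0 < e" "W11_ball K f e \<subseteq> S"
    using bspec[OF conjunct2[OF S] IntD1[OF f]] by (elim exE conjE)
  obtain K' e' where K': "compact K'" "0 < e'" "W11_ball K' f e' \<subseteq> T"
    using bspec[OF conjunct2[OF T] IntD2[OF f]] by (elim exE conjE)
  have "W11_ball (K \<union> K') f (min e e') \<subseteq> S" "W11_ball (K \<union> K') f (min e e') \<subseteq> T"
    using W11_ball_mono[of K "K \<union> K'" "min e e'" e f] W11_ball_mono[of K' "K \<union> K'" "min e e'" e' f]
      K K' by (auto simp: compact_Un)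
  then show "\<exists>K e. compact K \<and> 0 < e \<and> W11_ball K f e \<subseteq> S \<inter> T"
    using K K' by (intro exI[of _ "K \<union> K'"] exI[of _ "min e e'"]) (auto simp: compact_Un)
next
  fix S T :: "('a \<Rightarrow> real) set"
  assume "S \<subseteq> W11_loc \<and> (\<forall>f\<in>S. \<exists>K e. compact K \<and> 0 < e \<and> W11_ball K f e \<subseteq> S)"
  then show "S \<inter> T \<subseteq> W11_loc" by blast
next
  fix \<K> :: "('a \<Rightarrow> real) set set"
  assume "\<forall>U\<in>\<K>. U \<subseteq> W11_loc \<and> (\<forall>f\<in>U. \<exists>K e. compact K \<and> 0 < e \<and> W11_ball K f e \<subseteq> U)"
  then show "\<Union>\<K> \<subseteq> W11_loc" by blast
next
  fix \<K> :: "('a \<Rightarrow> real) set set" and f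
  assume *: "\<forall>U\<in>\<K>. U \<subseteq> W11_loc \<and> (\<forall>f\<in>U. \<exists>K e. compact K \<and> 0 < e \<and> W11_ball K f e \<subseteq> U)"
    and "f \<in> \<Union>\<K>"
  then obtain U where U: "U \<in> \<K>" "f \<in> U" by (elim UnionE)
  have "\<exists>K e. compact K \<and> 0 < e \<and> W11_ball K f e \<subseteq> U"
    by (rule bspec[OF conjunct2[OF bspec[OF * U(1)]] U(2)])
  then obtain K e where "compact K" "0 < e" "W11_ball K f e \<subseteq> U" by (elim exE conjE)
  moreover from this(3) have "W11_ball K f e \<subseteq> \<Union>\<K>"
    by (rule order_trans) (rule Union_upper[OF U(1)])
  ultimately show "\<exists>K e. compact K \<and> 0 < e \<and> W11_ball K f e \<subseteq> \<Union>\<K>"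
    by (intro exI conjI)
qed

lemma openin_W11_loc_topology:
  "openin W11_loc_topology U \<longleftrightarrow> U \<subseteq> W11_loc \<and>
    (\<forall>f\<in>U. \<exists>K e. compact K \<and> 0 < e \<and> W11_ball K f e \<subseteq> U)"
  unfolding W11_loc_topology_def by (simp only: topology_inverse'[OF istopology_W11_loc])

lemma topspace_W11_loc_topology: "topspace W11_loc_topology = W11_loc"
proof -
  have "W11_ball {} f 1 \<subseteq> W11_loc" for f :: "'a \<Rightarrow> real"
    by (auto simp: W11_ball_def)
  then have "openin W11_loc_topology (W11_loc :: ('a \<Rightarrow> real) set)"
    unfolding openin_W11_loc_topology by (meson compact_empty subset_refl zero_less_one)
  moreover have "topspace W11_loc_topology \<subseteq> (W11_loc :: ('a \<Rightarrow> real) set)"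
    using openin_topspace[of "W11_loc_topology :: ('a \<Rightarrow> real) topology"]
    unfolding openin_W11_loc_topology by blast
  ultimately show ?thesis
    by (simp add: openin_subset subset_antisym)
qed

end

theory Submission
  imports Defs
begin

text \<open>
  By the change of variables \<open>y = x - t q\<close>, \<open>S\<^sub>t u\<close> is the infimum over \<open>q\<close> of \<open>u (x - t q) + t L q\<close>, and
  for \<open>u\<close> with Lipschitz constant at most \<open>M\<close> the minimizers \<open>q\<close> lie in a ball that depends only on
  \<open>t\<close>, \<open>M\<close> and \<open>H\<close>, because \<open>L\<close> is superlinear. Strict convexity of \<open>H\<close> makes the maximizer
  in the Legendre transform unique, hence continuous in \<open>q\<close>, so that \<open>L\<close> is of class \<open>C\<^sup>1\<close>. Therefore
  \<open>S\<^sub>t u\<close> is touched from above at every point by a function of class \<open>C\<^sup>1\<close> whose gradient has a modulus of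
  continuity that does not depend on \<open>u\<close>: all the functions \<open>S\<^sub>t u\<close> are semiconcave with one
  common modulus (lemma \<open>hopf_lax_uniformly_semiconcave\<close>).
  
  For a function \<open>w\<close> with such a modulus, the right derivative in every coordinate direction \<open>b\<close> exists
  everywhere, and up to \<open>2 \<epsilon>\<close> it lies between the forward and the backward difference quotient
  with step \<open>h\<close>, for \<open>h \<le> \<delta> \<epsilon>\<close>. Passing to the limit in the discrete integration by parts
  shows that the right derivatives form a weak gradient (lemma \<open>weak_gradient_rgrad\<close>); Rademacher's
  theorem is not needed. If two such functions \<open>v\<close> and \<open>w\<close> are uniformly close, so are their
  difference quotients, and the derivatives differ by little more than the gap between the backward
  and the forward quotient of \<open>w\<close>. The integral of this gap telescopes under a translation by
  \<open>h b\<close>, so it is \<open>O(h)\<close>. Hence locally uniform convergence within the class implies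
  convergence of the gradients in \<open>L\<^sup>1\<close> on compact sets (lemma \<open>uniformly_close_in_W11_ball\<close>).
  
  The set of all \<open>M\<close>-Lipschitz \<open>u\<close> with \<open>\<bar>u 0\<bar> \<le> m\<close> is compact for pointwise convergence by Tychonoff's
  theorem, pointwise convergence on it is locally uniform, and \<open>S\<^sub>t\<close> preserves locally uniform
  convergence. So \<open>S\<^sub>t\<close> is continuous from this compact space to the local Sobolev space, and its image is
  compact (lemma \<open>compactin_hopf_lax_image\<close>). The topology of the Sobolev space is regular, so the
  closure of a subset of a compact set is compact.
\<close>

section \<open>The Legendre transform and the Hopf--Lax formula\<close>

text \<open>
  Semiconcavity in the coordinate directions, stated through supergradients: along each coordinate
  line, \<open>w\<close> lies below an affine function with slope \<open>p\<close> up to an error \<open>\<epsilon> \<bar>s\<bar>\<close>. The function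
  \<open>\<delta>\<close> is the modulus; it does not depend on the base point.
\<close>

definition uniformly_semiconcave :: "(real \<Rightarrow> real) \<Rightarrow> ('a::euclidean_space \<Rightarrow> real) \<Rightarrow> bool" where
  "uniformly_semiconcave \<delta> w \<longleftrightarrow> (\<forall>\<epsilon>>0. 0 < \<delta> \<epsilon> \<and>
    (\<forall>z. \<forall>b\<in>Basis. \<exists>p. \<forall>s. \<bar>s\<bar> \<le> \<delta> \<epsilon> \<longrightarrow> w (z + s *\<^sub>R b) \<le> w z + s * p + \<epsilon> * \<bar>s\<bar>))"

text \<open>
  Superlinear growth makes the Legendre transform of \<open>H\<close> finite and attained, and strict convexity makes
  it continuously differentiable.
\<close>

locale superlinear_convex =
  fixes H :: "'a::euclidean_space \<Rightarrow> real"
  assumes continuous: "continuous_on UNIV H"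
    and superlinear: "filterlim (\<lambda>p. H p / norm p) at_top at_infinity"
    and convex: "strictly_convex H"
begin

lemma superlinear_ge:
  obtains r where "1 \<le> r" "\<And>p. r \<le> norm p \<Longrightarrow> C * norm p \<le> H p"
proof -
  have "eventually (\<lambda>p. C \<le> H p / norm p) at_infinity"
    using superlinear by (simp add: filterlim_at_top)
  then obtain b where b: "\<And>p. b \<le> norm p \<Longrightarrow> C \<le> H p / norm p"
    by (auto simp: eventually_at_infinity)
  show thesis
  proof (rule that[of "max 1 b"])
    fix p :: 'a assume "max 1 b \<le> norm p"
    then have "C \<le> H p / norm p" "0 < norm p" using b[of p] by auto
    then show "C * norm p \<le> H p" by (simp add: field_simps)
  qed simp
qed

text \<open>
  The points at which the supremum that defines the Legendre transform at \<open>q\<close> is attained.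
\<close>

definition maximizer :: "'a \<Rightarrow> 'a \<Rightarrow> bool" where
  "maximizer q p \<longleftrightarrow> (\<forall>p'. p' \<bullet> q - H p' \<le> p \<bullet> q - H p)"

text \<open>
  The maximizer at \<open>q\<close>, which exists and is unique by the lemmas below. It is the gradient of the
  Legendre transform at \<open>q\<close>.
\<close>

definition argmax :: "'a \<Rightarrow> 'a" where
  "argmax q = (SOME p. maximizer q p)"

text \<open>
  For \<open>q\<close> in the ball of radius \<open>R\<close>, points far from the origin do worse than the point \<open>0\<close>.
\<close>

lemma outside_value_less:
  assumes "1 \<le> r" "\<And>p. r \<le> norm p \<Longrightarrow> (R + \<bar>H 0\<bar> + 1) * norm p \<le> H p" "norm q \<le> R" "r \<le> norm p"
  shows "p \<bullet> q - H p < 0 \<bullet> q - H 0"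
proof -
  have "p \<bullet> q \<le> norm p * norm q" by (rule norm_cauchy_schwarz)
  also have "\<dots> \<le> norm p * R" using assms(3) by (intro mult_left_mono) auto
  finally have "p \<bullet> q - H p \<le> norm p * R - (R + \<bar>H 0\<bar> + 1) * norm p"
    using assms(2)[OF assms(4)] by simp
  also have "\<dots> = - ((\<bar>H 0\<bar> + 1) * norm p)" by (simp add: algebra_simps)
  also have "\<dots> \<le> - ((\<bar>H 0\<bar> + 1) * 1)"
    using assms(1,4) by (intro le_imp_neg_le mult_left_mono) auto
  finally show ?thesis by simp
qed

lemma maximizer_exists: "\<exists>p. maximizer q p"
proof -
  obtain r where r: "1 \<le> r" "\<And>p. r \<le> norm p \<Longrightarrow> (norm q + \<bar>H 0\<bar> + 1) * norm p \<le> H p"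
    using superlinear_ge by metis
  have "\<exists>p\<in>cball 0 r. \<forall>p'\<in>cball 0 r. p' \<bullet> q - H p' \<le> p \<bullet> q - H p"
    using r(1) by (intro continuous_attains_sup continuous_intros continuous_on_subset[OF continuous]) auto
  then obtain p where p: "p \<in> cball 0 r" "\<And>p'. p' \<in> cball 0 r \<Longrightarrow> p' \<bullet> q - H p' \<le> p \<bullet> q - H p"
    by blast
  have "p' \<bullet> q - H p' \<le> p \<bullet> q - H p" for p'
  proof (cases "norm p' \<le> r")
    case False
    then have "p' \<bullet> q - H p' < 0 \<bullet> q - H 0"
      by (intro outside_value_less[OF r order_refl]) auto
    with p(2)[of 0] r(1) show ?thesis by auto
  qed (use p(2)[of p'] in auto)
  then show ?thesis by (auto simp: maximizer_def)
qed

lemma maximizer_argmax: "maximizer q (argmax q)"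
  unfolding argmax_def by (rule someI_ex) (rule maximizer_exists)

lemma maximizer_unique:
  assumes "maximizer q p" "maximizer q p'"
  shows "p = p'"
proof (rule ccontr)
  assume "p \<noteq> p'"
  then have "H ((1 - 1/2) *\<^sub>R p + (1/2) *\<^sub>R p') < (1 - 1/2) * H p + (1/2) * H p'"
    by (intro convex[unfolded strictly_convex_def, rule_format]) auto
  moreover have "((1 - 1/2) *\<^sub>R p + (1/2) *\<^sub>R p') \<bullet> q - H ((1 - 1/2) *\<^sub>R p + (1/2) *\<^sub>R p') \<le> p \<bullet> q - H p"
    using assms(1) unfolding maximizer_def by blast
  moreover have "((1 - 1/2) *\<^sub>R p + (1/2) *\<^sub>R p') \<bullet> q - H ((1 - 1/2) *\<^sub>R p + (1/2) *\<^sub>R p') \<le> p' \<bullet> q - H p'"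
    using assms(2) unfolding maximizer_def by blast
  ultimately show False
    by (simp add: inner_add_left)
qed

lemma legendre_eq: "legendre H q = argmax q \<bullet> q - H (argmax q)"
  unfolding legendre_def
  by (rule Greatest_equality) (use maximizer_argmax[of q] in \<open>auto simp: maximizer_def\<close>)

lemma legendre_ge: "p \<bullet> q - H p \<le> legendre H q"
  using maximizer_argmax[of q] by (auto simp: maximizer_def legendre_eq)

lemma argmax_bounded: "\<exists>r. \<forall>q\<in>cball 0 R. norm (argmax q) \<le> r"
proof -
  obtain r where r: "1 \<le> r" "\<And>p. r \<le> norm p \<Longrightarrow> (R + \<bar>H 0\<bar> + 1) * norm p \<le> H p"
    using superlinear_ge by metis
  have "norm (argmax q) \<le> r" if "q \<in> cball 0 R" for q
  proof (rule ccontr)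
    assume "\<not> norm (argmax q) \<le> r"
    then have "argmax q \<bullet> q - H (argmax q) < 0 \<bullet> q - H 0"
      using that by (intro outside_value_less[OF r]) auto
    with maximizer_argmax[of q] show False
      unfolding maximizer_def by (meson not_less)
  qed
  then show ?thesis by blast
qed

text \<open>
  By uniqueness, the graph of \<open>argmax\<close> is the closed set of all pairs \<open>(q, p)\<close> with \<open>p\<close> a maximizer
  at \<open>q\<close>; a locally bounded function with closed graph is continuous.
\<close>

lemma continuous_argmax: "continuous_on (cball 0 R) argmax"
proof -
  obtain r where r: "\<forall>q\<in>cball 0 R. norm (argmax q) \<le> r" using argmax_bounded by blast
  have "(\<lambda>q. (q, argmax q)) ` cball 0 R =
      cball 0 R \<times> UNIV \<inter> (\<Inter>p'. {z. p' \<bullet> fst z - H p' \<le> snd z \<bullet> fst z - H (snd z)})"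
    using maximizer_argmax maximizer_unique by (auto simp: maximizer_def image_iff)
  moreover have "closed {z. p' \<bullet> fst z - H p' \<le> snd z \<bullet> fst z - H (snd z)}" for p'
    by (intro closed_Collect_le continuous_intros continuous_on_compose2[OF continuous]) auto
  ultimately have "closed ((\<lambda>q. (q, argmax q)) ` cball 0 R)"
    by (auto intro!: closed_Int closed_Times closed_INT)
  then show ?thesis
    using r by (intro continuous_from_closed_graph[of "cball 0 r"]) auto
qed

lemma legendre_superlinear:
  assumes "0 \<le> C"
  shows "\<exists>c. \<forall>q. C * norm q - c \<le> legendre H q"
proof -
  have "\<exists>p\<in>cball 0 C. \<forall>p'\<in>cball 0 C. H p' \<le> H p"
    using assms by (intro continuous_attains_sup continuous_on_subset[OF continuous]) auto
  then obtain c where c: "\<And>p. norm p \<le> C \<Longrightarrow> H p \<le> c"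
    by (metis mem_cball_0)
  have "C * norm q - c \<le> legendre H q" for q
  proof -
    have "(C *\<^sub>R sgn q) \<bullet> q = C * norm q"
      by (cases "q = 0") (simp_all add: sgn_div_norm dot_square_norm power2_eq_square)
    moreover have "H (C *\<^sub>R sgn q) \<le> c"
      using assms by (intro c) (simp add: norm_sgn)
    ultimately show ?thesis using legendre_ge[of "C *\<^sub>R sgn q" q] by linarith
  qed
  then show ?thesis by blast
qed

lemma legendre_subgradient: "legendre H q' \<le> legendre H q + argmax q' \<bullet> (q' - q)"
  using legendre_ge[of "argmax q'" q] by (simp add: legendre_eq[of q'] inner_diff_right)

lemma continuous_legendre: "continuous_on UNIV (legendre H)"
proof (rule convex_on_continuous)
  show "convex_on UNIV (legendre H)"
  proof (rule convex_onI)
    fix t :: real and x y :: 'a assume t: "0 < t" "t < 1"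
    let ?z = "(1 - t) *\<^sub>R x + t *\<^sub>R y"
    have "legendre H ?z = (1 - t) * (argmax ?z \<bullet> x - H (argmax ?z)) + t * (argmax ?z \<bullet> y - H (argmax ?z))"
      by (simp add: legendre_eq inner_add_right algebra_simps)
    also have "\<dots> \<le> (1 - t) * legendre H x + t * legendre H y"
      using t by (intro add_mono mult_left_mono legendre_ge) auto
    finally show "legendre H ?z \<le> (1 - t) * legendre H x + t * legendre H y" .
  qed simp
qed simp

text \<open>
  The substitution \<open>y = x - t q\<close> is used throughout. Points that do at least as well as \<open>q = 0\<close> in the
  Hopf--Lax formula lie in a ball whose radius does not depend on \<open>u\<close> and \<open>x\<close>.
\<close>

lemma minimizer_bounded:
  assumes "0 < t" "0 \<le> M"
  shows "\<exists>R>0. \<forall>u x q. M-lipschitz_on UNIV u \<longrightarrow>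
    u (x - t *\<^sub>R q) + t * legendre H q \<le> u x + t * legendre H 0 \<longrightarrow> norm q \<le> R"
proof -
  obtain c where c: "\<And>q. (M + 1) * norm q - c \<le> legendre H q"
    using legendre_superlinear[of "M + 1"] assms by auto
  have "norm q \<le> \<bar>legendre H 0 + c\<bar> + 1"
    if u: "M-lipschitz_on UNIV u"
      and le: "u (x - t *\<^sub>R q) + t * legendre H q \<le> u x + t * legendre H 0" for u x q
  proof -
    have "dist (u x) (u (x - t *\<^sub>R q)) \<le> M * dist x (x - t *\<^sub>R q)"
      by (rule lipschitz_onD[OF u]) auto
    then have "u x - u (x - t *\<^sub>R q) \<le> t * (M * norm q)"
      using assms by (auto simp: dist_norm algebra_simps abs_le_iff)
    with le have "t * legendre H q \<le> t * (M * norm q + legendre H 0)"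
      by (simp add: algebra_simps)
    then have "legendre H q \<le> M * norm q + legendre H 0"
      using assms by simp
    with c[of q] show ?thesis by (simp add: algebra_simps)
  qed
  then show ?thesis by (intro exI[of _ "\<bar>legendre H 0 + c\<bar> + 1"]) auto
qed

lemma hopf_lax_attained:
  assumes "0 < t" "0 \<le> M"
  shows "\<exists>R>0. \<forall>u x. M-lipschitz_on UNIV u \<longrightarrow>
    (\<exists>q\<in>cball 0 R. hopf_lax H t u x = u (x - t *\<^sub>R q) + t * legendre H q) \<and>
    (\<forall>q. hopf_lax H t u x \<le> u (x - t *\<^sub>R q) + t * legendre H q)"
proof -
  obtain R where R: "R > 0" "\<And>u x q. M-lipschitz_on UNIV u \<Longrightarrow>
    u (x - t *\<^sub>R q) + t * legendre H q \<le> u x + t * legendre H 0 \<Longrightarrow> norm q \<le> R"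
    using minimizer_bounded[OF assms] by blast
  have "(\<exists>q\<in>cball 0 R. hopf_lax H t u x = u (x - t *\<^sub>R q) + t * legendre H q) \<and>
    (\<forall>q. hopf_lax H t u x \<le> u (x - t *\<^sub>R q) + t * legendre H q)"
    if u: "M-lipschitz_on UNIV u" for u x
  proof -
    define F where "F q = u (x - t *\<^sub>R q) + t * legendre H q" for q
    have "continuous_on (cball 0 R) F" unfolding F_def
      by (intro continuous_intros continuous_on_compose2[OF lipschitz_on_continuous_on[OF u]]
          continuous_on_subset[OF continuous_legendre]) auto
    then have "\<exists>q\<in>cball 0 R. \<forall>q'\<in>cball 0 R. F q \<le> F q'"
      using R(1) by (intro continuous_attains_inf) auto
    then obtain q where q: "q \<in> cball 0 R" "\<And>q'. q' \<in> cball 0 R \<Longrightarrow> F q \<le> F q'" by blast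
    have min: "F q \<le> F q'" for q'
    proof (cases "norm q' \<le> R")
      case False
      with R(2)[OF u, of x q'] have "F 0 < F q'" by (fastforce simp: F_def)
      moreover have "F q \<le> F 0" using q(2)[of 0] R(1) by simp
      ultimately show ?thesis by simp
    qed (use q(2)[of q'] in auto)
    have F: "u y + t * legendre H ((x - y) /\<^sub>R t) = F ((x - y) /\<^sub>R t)" for y
      using assms by (simp add: F_def)
    have "hopf_lax H t u x = F q"
      unfolding hopf_lax_def
    proof (rule Least_equality)
      show "\<exists>y. F q = u y + t * legendre H ((x - y) /\<^sub>R t)"
        using assms by (intro exI[of _ "x - t *\<^sub>R q"]) (simp add: F_def)
    qed (use min in \<open>auto simp: F\<close>)
    then show ?thesis using q(1) min by (auto simp: F_def)
  qed
  then show ?thesis using R(1) by blast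
qed

lemma hopf_lax_le:
  assumes "0 < t" "M-lipschitz_on UNIV u"
  shows "hopf_lax H t u x \<le> u (x - t *\<^sub>R q) + t * legendre H q"
  using hopf_lax_attained[OF assms(1) lipschitz_on_nonneg[OF assms(2)]] assms(2) by blast

lemma hopf_lax_lipschitz:
  assumes "0 < t" "M-lipschitz_on UNIV u"
  shows "M-lipschitz_on UNIV (hopf_lax H t u)"
proof (rule lipschitz_onI)
  have *: "hopf_lax H t u x \<le> hopf_lax H t u y + M * dist x y" for x y
  proof -
    obtain q where q: "hopf_lax H t u y = u (y - t *\<^sub>R q) + t * legendre H q"
      using hopf_lax_attained[OF assms(1) lipschitz_on_nonneg[OF assms(2)]] assms(2) by blast
    have "dist (u (x - t *\<^sub>R q)) (u (y - t *\<^sub>R q)) \<le> M * dist (x - t *\<^sub>R q) (y - t *\<^sub>R q)"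
      using lipschitz_onD[OF assms(2)] by auto
    then have "u (x - t *\<^sub>R q) \<le> u (y - t *\<^sub>R q) + M * dist x y"
      by (auto simp: dist_norm abs_le_iff)
    with hopf_lax_le[OF assms, of x q] q show ?thesis by simp
  qed
  show "dist (hopf_lax H t u x) (hopf_lax H t u y) \<le> M * dist x y" for x y
    using *[of x y] *[of y x] by (auto simp: dist_real_def abs_le_iff dist_commute)
qed (rule lipschitz_on_nonneg[OF assms(2)])

text \<open>
  Finite speed of propagation: the values of \<open>S\<^sub>t u\<close> on a ball depend only on those of \<open>u\<close> on a larger
  ball, and \<open>S\<^sub>t\<close> does not increase the supremum distance.
\<close>

lemma hopf_lax_local:
  assumes "0 < t" "0 \<le> M"
  shows "\<exists>R>0. \<forall>u v r \<eta>. M-lipschitz_on UNIV u \<longrightarrow> M-lipschitz_on UNIV v \<longrightarrow>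
    (\<forall>y\<in>cball 0 (r + R). \<bar>u y - v y\<bar> \<le> \<eta>) \<longrightarrow>
    (\<forall>x\<in>cball 0 r. \<bar>hopf_lax H t u x - hopf_lax H t v x\<bar> \<le> \<eta>)"
proof -
  obtain R where R: "R > 0" "\<And>u x. M-lipschitz_on UNIV u \<Longrightarrow>
    \<exists>q\<in>cball 0 R. hopf_lax H t u x = u (x - t *\<^sub>R q) + t * legendre H q"
    using hopf_lax_attained[OF assms] by blast
  have *: "hopf_lax H t u x \<le> hopf_lax H t v x + \<eta>"
    if u: "M-lipschitz_on UNIV u" and v: "M-lipschitz_on UNIV v"
      and le: "\<forall>y\<in>cball 0 (r + t * R). \<bar>u y - v y\<bar> \<le> \<eta>" and x: "x \<in> cball 0 r" for u v r \<eta> x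
  proof -
    obtain q where q: "q \<in> cball 0 R" "hopf_lax H t v x = v (x - t *\<^sub>R q) + t * legendre H q"
      using R(2)[OF v] by blast
    have "norm (x - t *\<^sub>R q) \<le> norm x + norm (t *\<^sub>R q)" by (rule norm_triangle_ineq4)
    also have "\<dots> \<le> r + t * R" using x q(1) assms(1) by (auto intro!: add_mono mult_left_mono)
    finally have "\<bar>u (x - t *\<^sub>R q) - v (x - t *\<^sub>R q)\<bar> \<le> \<eta>" using le by simp
    with hopf_lax_le[OF assms(1) u, of x q] q(2) show ?thesis by (simp add: abs_le_iff)
  qed
  show ?thesis
  proof (intro exI[of _ "t * R"] conjI allI impI ballI)
    fix u v :: "'a \<Rightarrow> real" and r \<eta> and x :: 'a
    assume h: "M-lipschitz_on UNIV u" "M-lipschitz_on UNIV v"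
      "\<forall>y\<in>cball 0 (r + t * R). \<bar>u y - v y\<bar> \<le> \<eta>" "x \<in> cball 0 r"
    then have "\<forall>y\<in>cball 0 (r + t * R). \<bar>v y - u y\<bar> \<le> \<eta>" by (metis abs_minus_commute)
    with *[OF h] *[OF h(2,1) _ h(4), of \<eta>]
    show "\<bar>hopf_lax H t u x - hopf_lax H t v x\<bar> \<le> \<eta>" by (auto simp: abs_le_iff)
  qed (use R(1) assms in auto)
qed

text \<open>
  Let \<open>q\<close> be optimal at \<open>z\<close>. Keeping the foot point \<open>z - t q\<close> fixed while \<open>z\<close> moves gives a competitor
  at \<open>z + s b\<close>; it touches \<open>S\<^sub>t u\<close> from above at \<open>z\<close>, with slope \<open>argmax q \<bullet> b\<close>.
\<close>

lemma hopf_lax_touched: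
  assumes "0 < t" "0 \<le> M" "0 < \<epsilon>"
  shows "\<exists>\<delta>>0. \<forall>u z. \<forall>b\<in>Basis. M-lipschitz_on UNIV u \<longrightarrow> (\<exists>p. \<forall>s. \<bar>s\<bar> \<le> \<delta> \<longrightarrow>
    hopf_lax H t u (z + s *\<^sub>R b) \<le> hopf_lax H t u z + s * p + \<epsilon> * \<bar>s\<bar>)"
proof -
  obtain R where R: "R > 0" "\<And>u x. M-lipschitz_on UNIV u \<Longrightarrow>
    \<exists>q\<in>cball 0 R. hopf_lax H t u x = u (x - t *\<^sub>R q) + t * legendre H q"
    using hopf_lax_attained[OF assms(1,2)] by blast
  have "uniformly_continuous_on (cball 0 (R + 1)) argmax"
    by (intro compact_uniformly_continuous continuous_argmax) auto
  then obtain d where d: "d > 0" "\<And>q q'. q \<in> cball 0 (R + 1) \<Longrightarrow> q' \<in> cball 0 (R + 1) \<Longrightarrow>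
      dist q' q < d \<Longrightarrow> dist (argmax q') (argmax q) < \<epsilon>"
    using assms(3) unfolding uniformly_continuous_on_def by metis
  define \<delta> where "\<delta> = t * min 1 (d / 2)"
  have "\<exists>p. \<forall>s. \<bar>s\<bar> \<le> \<delta> \<longrightarrow>
      hopf_lax H t u (z + s *\<^sub>R b) \<le> hopf_lax H t u z + s * p + \<epsilon> * \<bar>s\<bar>"
    if u: "M-lipschitz_on UNIV u" and b: "b \<in> Basis" for u z b
  proof -
    obtain q where q: "q \<in> cball 0 R" "hopf_lax H t u z = u (z - t *\<^sub>R q) + t * legendre H q"
      using R(2)[OF u] by blast
    have "hopf_lax H t u (z + s *\<^sub>R b) \<le> hopf_lax H t u z + s * (argmax q \<bullet> b) + \<epsilon> * \<bar>s\<bar>"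
      if s: "\<bar>s\<bar> \<le> \<delta>" for s
    proof -
      \<comment> \<open>the velocity from the same foot point to the moved point\<close>
      define q' where "q' = q + (s / t) *\<^sub>R b"
      have tq': "t *\<^sub>R q' = t *\<^sub>R q + s *\<^sub>R b" using assms by (simp add: q'_def scaleR_add_right)
      have dist: "dist q' q = \<bar>s\<bar> / t" using b assms by (simp add: q'_def dist_norm)
      have "\<bar>s\<bar> / t \<le> min 1 (d / 2)"
        using s assms by (simp only: \<delta>_def pos_divide_le_eq mult.commute)
      then have st: "\<bar>s\<bar> / t \<le> 1" "\<bar>s\<bar> / t < d" using d(1) by linarith+
      have "norm q' \<le> R + 1"
        using q(1) dist st norm_triangle_sub[of q' q] by (auto simp: dist_norm)
      then have "dist (argmax q') (argmax q) < \<epsilon>"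
        using q(1) dist st d(1) by (intro d(2)) auto
      then have "\<bar>(argmax q' - argmax q) \<bullet> b\<bar> \<le> \<epsilon>"
        using Basis_le_norm[OF b, of "argmax q' - argmax q"] by (simp add: dist_norm)
      then have "\<bar>s\<bar> * \<bar>(argmax q' - argmax q) \<bullet> b\<bar> \<le> \<epsilon> * \<bar>s\<bar>"
        by (metis abs_ge_zero mult.commute mult_left_mono)
      then have close: "s * ((argmax q' - argmax q) \<bullet> b) \<le> \<epsilon> * \<bar>s\<bar>"
        by (metis abs_le_D1 abs_mult order_trans abs_ge_self)
      have "hopf_lax H t u (z + s *\<^sub>R b) \<le> u (z + s *\<^sub>R b - t *\<^sub>R q') + t * legendre H q'"
        by (rule hopf_lax_le[OF assms(1) u])
      also have "\<dots> = u (z - t *\<^sub>R q) + t * legendre H q'" by (simp add: tq')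
      also have "\<dots> \<le> u (z - t *\<^sub>R q) + t * (legendre H q + argmax q' \<bullet> (q' - q))"
        using assms by (intro add_left_mono mult_left_mono legendre_subgradient) auto
      also have "\<dots> = hopf_lax H t u z + s * (argmax q' \<bullet> b)"
        using assms by (simp add: q(2) q'_def algebra_simps)
      also have "\<dots> \<le> hopf_lax H t u z + s * (argmax q \<bullet> b) + \<epsilon> * \<bar>s\<bar>"
        using close by (simp add: inner_diff_left algebra_simps)
      finally show ?thesis .
    qed
    then show ?thesis by blast
  qed
  moreover have "\<delta> > 0" using assms d(1) by (simp add: \<delta>_def)
  ultimately show ?thesis by blast
qed

lemma hopf_lax_uniformly_semiconcave:
  assumes "0 < t" "0 \<le> M"
  shows "\<exists>\<delta>. \<forall>u. M-lipschitz_on UNIV u \<longrightarrow> uniformly_semiconcave \<delta> (hopf_lax H t u)"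
proof -
  define P where "P \<epsilon> \<delta> \<longleftrightarrow> 0 < \<delta> \<and> (\<forall>u z. \<forall>b\<in>Basis. M-lipschitz_on UNIV u \<longrightarrow>
      (\<exists>p. \<forall>s. \<bar>s\<bar> \<le> \<delta> \<longrightarrow>
        hopf_lax H t u (z + s *\<^sub>R b) \<le> hopf_lax H t u z + s * p + \<epsilon> * \<bar>s\<bar>))" for \<epsilon> \<delta>
  have "\<exists>\<delta>. P \<epsilon> \<delta>" if "0 < \<epsilon>" for \<epsilon>
    unfolding P_def by (rule hopf_lax_touched[OF assms that])
  then obtain \<delta> where "\<And>\<epsilon>. 0 < \<epsilon> \<Longrightarrow> P \<epsilon> (\<delta> \<epsilon>)" by metis
  then have "uniformly_semiconcave \<delta> (hopf_lax H t u)" if "M-lipschitz_on UNIV u" for u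
    using that unfolding uniformly_semiconcave_def P_def by simp
  then show ?thesis by blast
qed

end

section \<open>One-sided derivatives of semiconcave functions\<close>

text \<open>
  A fixed sequence of steps decreasing to \<open>0\<close>.
\<close>

definition step :: "nat \<Rightarrow> real" where
  "step k = inverse (real (Suc k))"

text \<open>
  The right derivative of \<open>w\<close> at \<open>x\<close> in the direction \<open>b\<close>. Taking the limit along a sequence of steps
  makes measurability in \<open>x\<close> immediate.
\<close>

definition rderiv :: "('a::euclidean_space \<Rightarrow> real) \<Rightarrow> 'a \<Rightarrow> 'a \<Rightarrow> real" where
  "rderiv w b x = lim (\<lambda>k. (w (x + step k *\<^sub>R b) - w x) / step k)"

lemma step_pos: "0 < step k" and step_le_1: "step k \<le> 1"
  by (auto simp: step_def inverse_le_1_iff)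

lemma step_tendsto_0: "step \<longlonglongrightarrow> 0"
  unfolding step_def by (rule LIMSEQ_inverse_real_of_nat)

lemma step_less: "0 < h \<Longrightarrow> \<exists>N. \<forall>k\<ge>N. step k < h"
  using order_tendstoD(2)[OF step_tendsto_0] by (simp add: eventually_sequentially)

lemma step_antimono: "j \<le> k \<Longrightarrow> step k \<le> step j"
  by (simp add: step_def)

lemma uniformly_semiconcaveD:
  assumes "uniformly_semiconcave \<delta> w" "0 < \<epsilon>" "b \<in> Basis"
  obtains p where "\<And>s. \<bar>s\<bar> \<le> \<delta> \<epsilon> \<Longrightarrow> w (z + s *\<^sub>R b) \<le> w z + s * p + \<epsilon> * \<bar>s\<bar>"
  using assms unfolding uniformly_semiconcave_def by metis

text \<open>
  For a concave function the forward difference quotient increases as the step decreases; here it does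
  so up to \<open>2 \<epsilon>\<close>. The proof uses a supergradient at the intermediate point \<open>z = x + h' b\<close>.
\<close>

lemma forward_quotient_almost_antimono:
  assumes "uniformly_semiconcave \<delta> w" "0 < \<epsilon>" "b \<in> Basis" "0 < h'" "h' \<le> h" "h \<le> \<delta> \<epsilon>"
  shows "(w (x + h *\<^sub>R b) - w x) / h \<le> (w (x + h' *\<^sub>R b) - w x) / h' + 2 * \<epsilon>"
proof -
  define z where "z = x + h' *\<^sub>R b"
  define D where "D = (w z - w x) / h'"
  obtain p where p: "\<And>s. \<bar>s\<bar> \<le> \<delta> \<epsilon> \<Longrightarrow> w (z + s *\<^sub>R b) \<le> w z + s * p + \<epsilon> * \<bar>s\<bar>"
    using uniformly_semiconcaveD[OF assms(1-3)] by blast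
  have D: "w z = w x + h' * D" using assms(4) by (simp add: D_def)
  have "w x \<le> w z - h' * p + \<epsilon> * h'"
    using p[of "- h'"] assms(4-6) by (simp add: z_def)
  then have "h' * p \<le> h' * (D + \<epsilon>)" by (simp add: D algebra_simps)
  then have pD: "p \<le> D + \<epsilon>" using assms(4) by simp
  have "z + (h - h') *\<^sub>R b = x + h *\<^sub>R b" by (simp add: z_def algebra_simps)
  then have "w (x + h *\<^sub>R b) \<le> w z + (h - h') * p + \<epsilon> * (h - h')"
    using p[of "h - h'"] assms(4-6) by simp
  also have "\<dots> \<le> w z + (h - h') * (D + \<epsilon>) + \<epsilon> * (h - h')"
    using mult_left_mono[OF pD, of "h - h'"] assms(5) by simp
  also have "\<dots> = w x + h * (D + 2 * \<epsilon>) - 2 * \<epsilon> * h'" by (simp add: D algebra_simps)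
  also have "\<dots> \<le> w x + h * (D + 2 * \<epsilon>)" using assms(2,4) by simp
  finally have "w (x + h *\<^sub>R b) - w x \<le> (D + 2 * \<epsilon>) * h" by (simp add: mult.commute)
  then show ?thesis
    using assms(4,5) by (simp add: pos_divide_le_eq D_def z_def)
qed

lemma forward_quotient_le_backward:
  assumes "uniformly_semiconcave \<delta> w" "0 < \<epsilon>" "b \<in> Basis" "0 < h'" "h' \<le> \<delta> \<epsilon>" "0 < h" "h \<le> \<delta> \<epsilon>"
  shows "(w (x + h' *\<^sub>R b) - w x) / h' \<le> (w x - w (x - h *\<^sub>R b)) / h + 2 * \<epsilon>"
proof -
  obtain p where p: "\<And>s. \<bar>s\<bar> \<le> \<delta> \<epsilon> \<Longrightarrow> w (x + s *\<^sub>R b) \<le> w x + s * p + \<epsilon> * \<bar>s\<bar>"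
    using uniformly_semiconcaveD[OF assms(1-3)] by blast
  have "w (x + h' *\<^sub>R b) - w x \<le> (p + \<epsilon>) * h'"
    using p[of h'] assms by (simp add: algebra_simps)
  then have "(w (x + h' *\<^sub>R b) - w x) / h' \<le> p + \<epsilon>"
    using assms by (simp add: pos_divide_le_eq)
  moreover have "(p - \<epsilon>) * h \<le> w x - w (x - h *\<^sub>R b)"
    using p[of "- h"] assms by (simp add: algebra_simps)
  then have "p - \<epsilon> \<le> (w x - w (x - h *\<^sub>R b)) / h"
    using assms by (simp add: pos_le_divide_eq)
  ultimately show ?thesis by linarith
qed

lemma lipschitz_quotient_bound:
  fixes w :: "'a::euclidean_space \<Rightarrow> real"
  assumes "M-lipschitz_on UNIV w" "b \<in> Basis" "0 < h"
  shows "\<bar>(w (x + h *\<^sub>R b) - w x) / h\<bar> \<le> M"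
proof -
  have "dist (w (x + h *\<^sub>R b)) (w x) \<le> M * dist (x + h *\<^sub>R b) x"
    by (rule lipschitz_onD[OF assms(1)]) auto
  then show ?thesis
    using assms by (simp add: dist_norm abs_divide pos_divide_le_eq)
qed

text \<open>
  A bounded sequence that is increasing up to errors that tend to \<open>0\<close> converges.
\<close>

lemma convergent_almost_monotone:
  fixes q :: "nat \<Rightarrow> real"
  assumes bounded: "\<And>k. \<bar>q k\<bar> \<le> M"
    and mono: "\<And>\<epsilon>. 0 < \<epsilon> \<Longrightarrow> \<exists>N. \<forall>j\<ge>N. \<forall>k\<ge>j. q j \<le> q k + \<epsilon>"
  shows "convergent q"
proof -
  have "Cauchy q"
  proof (rule CauchyI')
    fix e :: real assume "0 < e"
    then obtain N where N: "\<And>j k. N \<le> j \<Longrightarrow> j \<le> k \<Longrightarrow> q j \<le> q k + e / 4"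
      using mono[of "e / 4"] by auto
    define s where "s = (SUP j\<in>{N..}. q j)"
    have bdd: "bdd_above (q ` {N..})"
      using bounded by (auto intro!: bdd_aboveI[of _ M] simp: abs_le_iff)
    have "s - e / 4 < (SUP j\<in>{N..}. q j)" using \<open>0 < e\<close> by (simp add: s_def)
    then obtain j where j: "N \<le> j" "s - e / 4 < q j"
      using less_cSUP_iff[OF _ bdd] by auto
    have close: "q k \<le> s" "s - e / 2 < q k" if "j \<le> k" for k
    proof -
      show "q k \<le> s" unfolding s_def using that j(1) by (intro cSUP_upper bdd) auto
      show "s - e / 2 < q k" using N[OF j(1) that] j(2) by simp
    qed
    show "\<exists>L. \<forall>m\<ge>L. \<forall>n>m. dist (q m) (q n) < e"
    proof (intro exI[of _ j] allI impI)
      fix m n assume "j \<le> m" "m < n"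
      then show "dist (q m) (q n) < e"
        using close[of m] close[of n] \<open>0 < e\<close> by (auto simp: dist_real_def)
    qed
  qed
  then show ?thesis by (rule Cauchy_convergent)
qed

context
  fixes M :: real and \<delta> :: "real \<Rightarrow> real" and w :: "'a::euclidean_space \<Rightarrow> real" and b :: 'a
  assumes lip: "M-lipschitz_on UNIV w" and sc: "uniformly_semiconcave \<delta> w" and b: "b \<in> Basis"
begin

lemma rderiv_tendsto: "(\<lambda>k. (w (x + step k *\<^sub>R b) - w x) / step k) \<longlonglongrightarrow> rderiv w b x"
  unfolding rderiv_def convergent_LIMSEQ_iff[symmetric]
proof (rule convergent_almost_monotone)
  show "\<bar>(w (x + step k *\<^sub>R b) - w x) / step k\<bar> \<le> M" for k
    by (rule lipschitz_quotient_bound[OF lip b step_pos])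
  fix \<epsilon> :: real assume "0 < \<epsilon>"
  then have \<epsilon>: "0 < \<epsilon> / 2" by simp
  then obtain N where N: "\<And>k. N \<le> k \<Longrightarrow> step k < \<delta> (\<epsilon> / 2)"
    using step_less sc unfolding uniformly_semiconcave_def by metis
  show "\<exists>N. \<forall>j\<ge>N. \<forall>k\<ge>j. (w (x + step j *\<^sub>R b) - w x) / step j
      \<le> (w (x + step k *\<^sub>R b) - w x) / step k + \<epsilon>"
  proof (intro exI[of _ N] allI impI)
    fix j k assume "N \<le> j" "j \<le> k"
    then show "(w (x + step j *\<^sub>R b) - w x) / step j \<le> (w (x + step k *\<^sub>R b) - w x) / step k + \<epsilon>"
      using forward_quotient_almost_antimono[OF sc \<epsilon> b step_pos step_antimono, of j k x] N[of j]
      by simp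
  qed
qed

lemma abs_rderiv_le: "\<bar>rderiv w b x\<bar> \<le> M"
  using lipschitz_quotient_bound[OF lip b step_pos]
  by (intro LIMSEQ_le_const2[OF tendsto_rabs[OF rderiv_tendsto]]) auto

lemma forward_quotient_le_rderiv:
  assumes "0 < \<epsilon>" "0 < h" "h \<le> \<delta> \<epsilon>"
  shows "(w (x + h *\<^sub>R b) - w x) / h \<le> rderiv w b x + 2 * \<epsilon>"
proof -
  obtain N where N: "\<And>k. N \<le> k \<Longrightarrow> step k < h" using step_less[OF assms(2)] by blast
  have "(w (x + h *\<^sub>R b) - w x) / h - 2 * \<epsilon> \<le> (w (x + step k *\<^sub>R b) - w x) / step k" if "N \<le> k" for k
    using forward_quotient_almost_antimono[OF sc assms(1) b step_pos less_imp_le[OF N[OF that]] assms(3), of x]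
    by simp
  then have "(w (x + h *\<^sub>R b) - w x) / h - 2 * \<epsilon> \<le> rderiv w b x"
    by (intro LIMSEQ_le_const[OF rderiv_tendsto]) auto
  then show ?thesis by simp
qed

lemma rderiv_le_backward_quotient:
  assumes "0 < \<epsilon>" "0 < h" "h \<le> \<delta> \<epsilon>"
  shows "rderiv w b x \<le> (w x - w (x - h *\<^sub>R b)) / h + 2 * \<epsilon>"
proof -
  obtain N where N: "\<And>k. N \<le> k \<Longrightarrow> step k < h" using step_less[OF assms(2)] by blast
  have "(w (x + step k *\<^sub>R b) - w x) / step k \<le> (w x - w (x - h *\<^sub>R b)) / h + 2 * \<epsilon>" if "N \<le> k" for k
    using N[OF that] assms by (intro forward_quotient_le_backward[OF sc assms(1) b step_pos]) auto
  then show ?thesis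
    by (intro LIMSEQ_le_const2[OF rderiv_tendsto]) auto
qed

lemma borel_measurable_rderiv: "rderiv w b \<in> borel_measurable borel"
proof (rule borel_measurable_LIMSEQ_real)
  have "continuous_on UNIV (\<lambda>x. (w (x + step k *\<^sub>R b) - w x) / step k)" for k
    by (intro continuous_intros continuous_on_compose2[OF lipschitz_on_continuous_on[OF lip]])
      (use step_pos[of k] in auto)
  then show "(\<lambda>x. (w (x + step k *\<^sub>R b) - w x) / step k) \<in> borel_measurable borel" for k
    by (rule borel_measurable_continuous_onI)
qed (rule rderiv_tendsto)

end

section \<open>Integrals\<close>

lemma integral_lborel_translate:
  fixes f :: "'a::euclidean_space \<Rightarrow> real"
  assumes "f \<in> borel_measurable borel"
  shows "(\<integral>x. f (x + c) \<partial>lborel) = (\<integral>x. f x \<partial>lborel)"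
proof -
  have "(\<integral>x. f x \<partial>distr lborel borel ((+) c)) = (\<integral>x. f (c + x) \<partial>lborel)"
    by (rule integral_distr) (use assms in auto)
  then show ?thesis by (simp add: lborel_distr_plus add.commute)
qed

lemma integrable_continuous_bounded_support:
  fixes f :: "'a::euclidean_space \<Rightarrow> 'b::euclidean_space"
  assumes "continuous_on UNIV f" "\<And>x. r < norm x \<Longrightarrow> f x = 0"
  shows "integrable lborel f"
proof -
  have "integrable lborel (\<lambda>x. indicator (cball 0 r) x *\<^sub>R f x)"
    by (intro borel_integrable_compact continuous_on_subset[OF assms(1)]) auto
  moreover have "(\<lambda>x. indicator (cball 0 r) x *\<^sub>R f x) = f"
    using assms(2) by (auto simp: fun_eq_iff indicator_def not_le)
  ultimately show ?thesis by simp
qed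

lemma integrable_indicator_bounded:
  fixes f :: "'a::euclidean_space \<Rightarrow> 'b::euclidean_space"
  assumes "f \<in> borel_measurable borel" "\<And>x. norm (f x) \<le> C" "compact K"
  shows "integrable lborel (\<lambda>x. indicator K x *\<^sub>R f x)"
proof -
  have [measurable]: "f \<in> borel_measurable borel" "K \<in> sets borel"
    using assms by (auto simp: compact_imp_closed)
  have "integrable lborel (\<lambda>x. indicator K x *\<^sub>R C)"
    using assms(3) by (intro borel_integrable_compact) auto
  then show ?thesis
    by (rule Bochner_Integration.integrable_bound)
      (use assms(2) in \<open>auto simp: indicator_def intro: order_trans[OF _ abs_ge_self]\<close>)
qed

lemma locally_integrable_bounded:
  fixes f :: "'a::euclidean_space \<Rightarrow> 'b::euclidean_space"
  assumes "f \<in> borel_measurable borel" "\<And>x. norm (f x) \<le> C"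
  shows "locally_integrable f"
  unfolding locally_integrable_def set_integrable_def
proof (intro allI impI)
  fix K :: "'a set" assume K: "compact K"
  note int = integrable_indicator_bounded[OF assms K]
  then have "(\<lambda>x. indicator K x *\<^sub>R f x) \<in> borel_measurable lborel" by simp
  with int show "integrable lebesgue (\<lambda>x. indicator K x *\<^sub>R f x)"
    by (simp only: integrable_completion)
qed

lemma locally_integrable_continuous:
  fixes f :: "'a::euclidean_space \<Rightarrow> 'b::euclidean_space"
  assumes "continuous_on UNIV f"
  shows "locally_integrable f"
  unfolding locally_integrable_def set_integrable_def
proof (intro allI impI)
  fix K :: "'a set" assume K: "compact K"
  have [measurable]: "f \<in> borel_measurable borel" "K \<in> sets borel"
    using assms K by (auto simp: borel_measurable_continuous_onI compact_imp_closed)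
  show "integrable lebesgue (\<lambda>x. indicator K x *\<^sub>R f x)"
    by (subst integrable_completion)
      (auto intro!: borel_integrable_compact K continuous_on_subset[OF assms])
qed

section \<open>Test functions\<close>

lemma GDERIV_grad:
  assumes "f differentiable (at x)"
  shows "GDERIV f x :> grad f x"
proof -
  obtain f' where f': "(f has_derivative f') (at x)" using assms by (auto simp: differentiable_def)
  then interpret bounded_linear f' by (rule has_derivative_bounded_linear)
  have "f' h = h \<bullet> (\<Sum>b\<in>Basis. f' b *\<^sub>R b)" for h
  proof -
    have "f' h = f' (\<Sum>b\<in>Basis. (h \<bullet> b) *\<^sub>R b)" by (simp add: euclidean_representation)
    also have "\<dots> = (\<Sum>b\<in>Basis. (h \<bullet> b) * f' b)" by (simp add: sum scaleR)
    finally show ?thesis by (simp add: inner_sum_right mult.commute)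
  qed
  then have "f' = (\<lambda>h. h \<bullet> (\<Sum>b\<in>Basis. f' b *\<^sub>R b))" by (rule ext)
  then have "GDERIV f x :> (\<Sum>b\<in>Basis. f' b *\<^sub>R b)" using f' unfolding gderiv_def by simp
  with grad_eqI[OF this] show ?thesis by simp
qed

context
  fixes \<phi> :: "'a::euclidean_space \<Rightarrow> real"
  assumes \<phi>: "test_function \<phi>"
begin

lemma test_function_GDERIV: "GDERIV \<phi> x :> grad \<phi> x"
proof -
  have "Ck (Suc 0) \<phi>" using \<phi> by (simp only: test_function_def)
  then show ?thesis by (simp add: GDERIV_grad)
qed

lemma continuous_test_function: "continuous_on A \<phi>"
  using test_function_GDERIV unfolding gderiv_def
  by (meson continuous_at_imp_continuous_on has_derivative_continuous)

lemma continuous_grad_test_function: "continuous_on A (grad \<phi>)"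
proof -
  have "Ck (Suc 0) \<phi>" using \<phi> by (simp only: test_function_def)
  then have "\<forall>b\<in>Basis. continuous_on UNIV (\<lambda>x. grad \<phi> x \<bullet> b)" by simp
  then have "continuous_on UNIV (\<lambda>x. \<Sum>b\<in>Basis. (grad \<phi> x \<bullet> b) *\<^sub>R b)"
    by (intro continuous_on_sum continuous_on_scaleR continuous_on_const) auto
  then show ?thesis by (simp add: euclidean_representation continuous_on_subset[of UNIV])
qed

lemma test_function_support: "\<exists>r>0. \<forall>x. r < norm x \<longrightarrow> \<phi> x = 0 \<and> grad \<phi> x = 0"
proof -
  have "bounded (closure {x. \<phi> x \<noteq> 0})" using \<phi> by (simp add: test_function_def compact_imp_bounded)
  then obtain r where r: "0 < r" "\<And>x. x \<in> closure {x. \<phi> x \<noteq> 0} \<Longrightarrow> norm x \<le> r"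
    by (auto simp: bounded_pos)
  have zero: "\<phi> x = 0" if "r < norm x" for x
    using r(2)[of x] that closure_subset[of "{x. \<phi> x \<noteq> 0}"] by force
  have "grad \<phi> x = 0" if "r < norm x" for x
  proof -
    have "open {x::'a. r < norm x}" by (intro open_Collect_less continuous_intros)
    moreover have "GDERIV (\<lambda>x. 0) x :> 0" by (rule GDERIV_const)
    ultimately have "GDERIV \<phi> x :> 0"
      unfolding gderiv_def using that zero by (elim has_derivative_transform_within_open[rotated 1]) auto
    then show ?thesis by (rule grad_eqI)
  qed
  with zero r(1) show ?thesis by blast
qed

lemma grad_test_function_bounded: "\<exists>C>0. \<forall>x. norm (grad \<phi> x) \<le> C"
proof -
  obtain r where r: "0 < r" "\<And>x. r < norm x \<Longrightarrow> grad \<phi> x = 0" using test_function_support by blast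
  have "bounded (grad \<phi> ` cball 0 r)"
    by (intro compact_imp_bounded compact_continuous_image continuous_grad_test_function) auto
  then obtain C where C: "0 < C" "\<And>x. norm x \<le> r \<Longrightarrow> norm (grad \<phi> x) \<le> C"
    by (auto simp: bounded_pos)
  have "norm (grad \<phi> x) \<le> C" for x
    using C r(2)[of x] by (cases "norm x \<le> r") auto
  with C(1) show ?thesis by blast
qed

lemma test_function_lipschitz: "\<exists>C>0. C-lipschitz_on UNIV \<phi>"
proof -
  obtain C where C: "0 < C" "\<And>x. norm (grad \<phi> x) \<le> C" using grad_test_function_bounded by blast
  have "norm (\<phi> x - \<phi> y) \<le> C * norm (x - y)" for x y
  proof (rule differentiable_bound[of UNIV])
    show "(\<phi> has_derivative (\<lambda>h. h \<bullet> grad \<phi> x)) (at x within UNIV)" for x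
      using test_function_GDERIV by (simp add: gderiv_def)
    show "onorm (\<lambda>h. h \<bullet> grad \<phi> x) \<le> C" for x
    proof (rule onorm_bound)
      fix h
      have "norm (h \<bullet> grad \<phi> x) \<le> norm h * norm (grad \<phi> x)" by (simp add: Cauchy_Schwarz_ineq2)
      also have "\<dots> \<le> C * norm h" using mult_left_mono[OF C(2)[of x] norm_ge_zero[of h]] by (simp add: mult.commute)
      finally show "norm (h \<bullet> grad \<phi> x) \<le> C * norm h" .
    qed (use C in auto)
  qed auto
  then show ?thesis using C(1) by (auto simp: lipschitz_on_def dist_norm)
qed

lemma test_function_quotient_tendsto:
  "(\<lambda>k. (\<phi> x - \<phi> (x - step k *\<^sub>R b)) / step k) \<longlonglongrightarrow> grad \<phi> x \<bullet> b"
proof -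
  have "((\<lambda>s. x - s *\<^sub>R b) has_derivative (\<lambda>s. - (s *\<^sub>R b))) (at (0::real))"
    by (auto intro!: derivative_eq_intros)
  moreover have "(\<phi> has_derivative (\<lambda>h. h \<bullet> grad \<phi> x)) (at (x - 0 *\<^sub>R b))"
    using test_function_GDERIV[of x] by (simp add: gderiv_def)
  ultimately have "((\<lambda>s. \<phi> (x - s *\<^sub>R b)) has_derivative (\<lambda>s. - (s *\<^sub>R b) \<bullet> grad \<phi> x)) (at 0)"
    by (rule has_derivative_compose)
  then have "((\<lambda>s. \<phi> (x - s *\<^sub>R b)) has_field_derivative - (b \<bullet> grad \<phi> x)) (at 0)"
    by (rule has_derivative_imp_has_field_derivative) (simp add: mult.commute)
  then have "((\<lambda>s. (\<phi> (x - s *\<^sub>R b) - \<phi> x) / s) \<longlongrightarrow> - (b \<bullet> grad \<phi> x)) (at 0)"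
    by (simp add: DERIV_def)
  moreover have "filterlim step (at 0) sequentially"
    using step_tendsto_0 step_pos by (auto simp: filterlim_at intro!: always_eventually) (metis less_irrefl)
  ultimately have "(\<lambda>k. (\<phi> (x - step k *\<^sub>R b) - \<phi> x) / step k) \<longlonglongrightarrow> - (b \<bullet> grad \<phi> x)"
    by (rule filterlim_compose)
  from tendsto_minus[OF this] show ?thesis by (simp add: inner_commute minus_divide_left)
qed

end

section \<open>The weak gradient of a semiconcave function\<close>

text \<open>
  Discrete integration by parts, by translation invariance of Lebesgue measure.
\<close>

lemma integral_quotient_swap:
  fixes f g :: "'a::euclidean_space \<Rightarrow> real"
  assumes f: "continuous_on UNIV f" and g: "continuous_on UNIV g"
    and supp: "\<And>x. r < norm x \<Longrightarrow> g x = 0"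
  shows "(\<integral>x. f x * ((g x - g (x - c)) / h) \<partial>lborel) = - (\<integral>x. g x * ((f (x + c) - f x) / h) \<partial>lborel)"
proof -
  have fc: "continuous_on UNIV (\<lambda>x. f (x + c))" and gc: "continuous_on UNIV (\<lambda>x. g (x - c))"
    by (auto intro!: continuous_on_compose2[OF f] continuous_on_compose2[OF g] continuous_intros)
  have "g (x - c) = 0" if "r + norm c < norm x" for x
    using supp[of "x - c"] norm_triangle_sub[of x c] that by auto
  then have "integrable lborel (\<lambda>x. f x * g (x - c))"
    by (intro integrable_continuous_bounded_support[of _ "r + norm c"] continuous_intros f gc) auto
  moreover have "integrable lborel (\<lambda>x. f x * g x)" "integrable lborel (\<lambda>x. f (x + c) * g x)"
    using supp
    by (intro integrable_continuous_bounded_support[of _ r] continuous_intros f g fc; simp)+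
  ultimately have int: "integrable lborel (\<lambda>x. f x * g x)" "integrable lborel (\<lambda>x. f x * g (x - c))"
    "integrable lborel (\<lambda>x. f (x + c) * g x)"
    by auto
  have "(\<integral>x. f (x + c) * g ((x + c) - c) \<partial>lborel) = (\<integral>x. f x * g (x - c) \<partial>lborel)"
    by (rule integral_lborel_translate) (intro borel_measurable_continuous_onI continuous_intros f gc)
  then have eq: "(\<integral>x. f (x + c) * g x \<partial>lborel) = (\<integral>x. f x * g (x - c) \<partial>lborel)" by simp
  have "(\<integral>x. f x * ((g x - g (x - c)) / h) \<partial>lborel) = (\<integral>x. (f x * g x - f x * g (x - c)) / h \<partial>lborel)"
    by (simp add: algebra_simps)
  also have "\<dots> = ((\<integral>x. f x * g x \<partial>lborel) - (\<integral>x. f x * g (x - c) \<partial>lborel)) / h"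
    using int by simp
  also have "\<dots> = - (((\<integral>x. f (x + c) * g x \<partial>lborel) - (\<integral>x. f x * g x \<partial>lborel)) / h)"
    by (simp add: eq minus_divide_left)
  also have "\<dots> = - (\<integral>x. (f (x + c) * g x - f x * g x) / h \<partial>lborel)"
    using int by simp
  also have "\<dots> = - (\<integral>x. g x * ((f (x + c) - f x) / h) \<partial>lborel)"
    by (simp add: algebra_simps)
  finally show ?thesis .
qed

text \<open>
  The vector of right derivatives in the coordinate directions.
\<close>

definition rgrad :: "('a::euclidean_space \<Rightarrow> real) \<Rightarrow> 'a \<Rightarrow> 'a" where
  "rgrad w x = (\<Sum>b\<in>Basis. rderiv w b x *\<^sub>R b)"

lemma rgrad_inner: "b \<in> Basis \<Longrightarrow> rgrad w x \<bullet> b = rderiv w b x"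
  by (simp add: rgrad_def)

lemma integral_rderiv_test_function:
  assumes lip: "M-lipschitz_on UNIV w" and sc: "uniformly_semiconcave \<delta> w" and b: "b \<in> Basis"
    and \<phi>: "test_function \<phi>"
  shows "(\<integral>x. w x * (grad \<phi> x \<bullet> b) \<partial>lborel) = - (\<integral>x. \<phi> x * rderiv w b x \<partial>lborel)"
proof -
  obtain r where r: "0 < r" "\<And>x. r < norm x \<Longrightarrow> \<phi> x = 0" using test_function_support[OF \<phi>] by blast
  obtain C where C: "0 < C" "C-lipschitz_on UNIV \<phi>" using test_function_lipschitz[OF \<phi>] by blast
  note cw = lipschitz_on_continuous_on[OF lip] and c\<phi> = continuous_test_function[OF \<phi>]
  have [measurable]: "w \<in> borel_measurable borel" "\<phi> \<in> borel_measurable borel"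
    "rderiv w b \<in> borel_measurable borel" "grad \<phi> \<in> borel_measurable borel"
    using borel_measurable_rderiv[OF lip sc b]
    by (auto intro!: borel_measurable_continuous_onI cw c\<phi> continuous_grad_test_function[OF \<phi>])
  define D where "D k x = (\<phi> x - \<phi> (x - step k *\<^sub>R b)) / step k" for k x
  define Q where "Q k x = (w (x + step k *\<^sub>R b) - w x) / step k" for k x
  have D_zero: "D k x = 0" if "r + 1 < norm x" for k x
  proof -
    have "norm x \<le> norm (x - step k *\<^sub>R b) + 1"
      using norm_triangle_sub[of x "step k *\<^sub>R b"] step_pos[of k] step_le_1[of k] b by simp
    with that r(2)[of x] r(2)[of "x - step k *\<^sub>R b"] show ?thesis by (simp add: D_def)
  qed
  have D_le: "\<bar>D k x\<bar> \<le> C" for k x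
    using lipschitz_quotient_bound[OF C(2) b step_pos, of "x - step k *\<^sub>R b" k] by (simp add: D_def)
  have lim_D: "(\<lambda>k. \<integral>x. w x * D k x \<partial>lborel) \<longlonglongrightarrow> (\<integral>x. w x * (grad \<phi> x \<bullet> b) \<partial>lborel)"
  proof (rule integral_dominated_convergence[where w = "\<lambda>x. indicator (cball 0 (r + 1)) x *\<^sub>R (\<bar>w x\<bar> * C)"])
    show "integrable lborel (\<lambda>x. indicator (cball 0 (r + 1)) x *\<^sub>R (\<bar>w x\<bar> * C))"
      by (intro borel_integrable_compact continuous_intros continuous_on_subset[OF cw]) auto
    show "AE x in lborel. (\<lambda>k. w x * D k x) \<longlonglongrightarrow> w x * (grad \<phi> x \<bullet> b)"
      unfolding D_def by (intro AE_I2 tendsto_mult_left test_function_quotient_tendsto[OF \<phi>])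
    show "AE x in lborel. norm (w x * D k x) \<le> indicator (cball 0 (r + 1)) x *\<^sub>R (\<bar>w x\<bar> * C)" for k
      using D_le D_zero by (intro AE_I2) (auto simp: indicator_def abs_mult mult_left_mono)
  qed (auto simp: D_def)
  have lim_Q: "(\<lambda>k. \<integral>x. \<phi> x * Q k x \<partial>lborel) \<longlonglongrightarrow> (\<integral>x. \<phi> x * rderiv w b x \<partial>lborel)"
  proof (rule integral_dominated_convergence[where w = "\<lambda>x. \<bar>\<phi> x\<bar> * M"])
    show "integrable lborel (\<lambda>x. \<bar>\<phi> x\<bar> * M)"
      using r(2) by (intro integrable_continuous_bounded_support[of _ r] continuous_intros c\<phi>) auto
    show "AE x in lborel. (\<lambda>k. \<phi> x * Q k x) \<longlonglongrightarrow> \<phi> x * rderiv w b x"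
      unfolding Q_def by (intro AE_I2 tendsto_mult_left rderiv_tendsto[OF lip sc b])
    show "AE x in lborel. norm (\<phi> x * Q k x) \<le> \<bar>\<phi> x\<bar> * M" for k
      using lipschitz_quotient_bound[OF lip b step_pos]
      by (intro AE_I2) (simp add: Q_def abs_mult mult_left_mono del: abs_divide times_divide_eq_right)
  qed (auto simp: Q_def)
  have "(\<integral>x. w x * D k x \<partial>lborel) = - (\<integral>x. \<phi> x * Q k x \<partial>lborel)" for k
    unfolding D_def Q_def by (rule integral_quotient_swap[OF cw c\<phi> r(2)])
  then have "(\<lambda>k. \<integral>x. w x * D k x \<partial>lborel) \<longlonglongrightarrow> - (\<integral>x. \<phi> x * rderiv w b x \<partial>lborel)"
    using tendsto_minus[OF lim_Q] by simp
  with lim_D show ?thesis by (rule LIMSEQ_unique)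
qed

lemma weak_gradient_rgrad:
  assumes lip: "M-lipschitz_on UNIV w" and sc: "uniformly_semiconcave \<delta> w"
  shows "weak_gradient w (rgrad w)"
  unfolding weak_gradient_def
proof (intro conjI allI impI)
  note cw = lipschitz_on_continuous_on[OF lip]
  have meas: "rgrad w \<in> borel_measurable borel"
    using borel_measurable_rderiv[OF lip sc] unfolding rgrad_def
    by (intro borel_measurable_sum borel_measurable_scaleR) auto
  have bound: "norm (rgrad w x) \<le> real DIM('a) * M" for x
  proof -
    have "norm (rgrad w x) \<le> (\<Sum>b\<in>Basis. norm (rderiv w b x *\<^sub>R b))"
      unfolding rgrad_def by (rule norm_sum)
    also have "\<dots> \<le> real DIM('a) * M"
      by (rule sum_bounded_above) (simp add: abs_rderiv_le[OF lip sc])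
    finally show ?thesis .
  qed
  show "locally_integrable w" by (rule locally_integrable_continuous[OF cw])
  show "locally_integrable (rgrad w)" by (rule locally_integrable_bounded[OF meas bound])
  fix \<phi> :: "'a \<Rightarrow> real" assume \<phi>: "test_function \<phi>"
  obtain r where r: "\<And>x. r < norm x \<Longrightarrow> \<phi> x = 0 \<and> grad \<phi> x = 0"
    using test_function_support[OF \<phi>] by blast
  note c\<phi> = continuous_test_function[OF \<phi>] and cg = continuous_grad_test_function[OF \<phi>]
  have int1: "integrable lborel (\<lambda>x. w x *\<^sub>R grad \<phi> x)"
    using r by (intro integrable_continuous_bounded_support[of _ r] continuous_intros cw cg) auto
  have "integrable lborel (\<lambda>x. \<phi> x * (real DIM('a) * M))"
    using r by (intro integrable_continuous_bounded_support[of _ r] continuous_intros c\<phi>) auto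
  then have int2: "integrable lborel (\<lambda>x. \<phi> x *\<^sub>R rgrad w x)"
  proof (rule Bochner_Integration.integrable_bound)
    show "(\<lambda>x. \<phi> x *\<^sub>R rgrad w x) \<in> borel_measurable lborel"
      using meas borel_measurable_continuous_onI[OF c\<phi>] by simp
    show "AE x in lborel. norm (\<phi> x *\<^sub>R rgrad w x) \<le> norm (\<phi> x * (real DIM('a) * M))"
      using bound by (intro AE_I2)
        (auto simp: abs_mult intro!: mult_left_mono order_trans[OF bound])
  qed
  have "(\<integral>x. w x *\<^sub>R grad \<phi> x \<partial>lborel) = - (\<integral>x. \<phi> x *\<^sub>R rgrad w x \<partial>lborel)"
  proof (rule euclidean_eqI)
    fix b :: 'a assume b: "b \<in> Basis"
    have "(\<integral>x. w x *\<^sub>R grad \<phi> x \<partial>lborel) \<bullet> b = (\<integral>x. w x * (grad \<phi> x \<bullet> b) \<partial>lborel)"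
      using integral_inner_left[OF int1, of b] by simp
    also have "\<dots> = - (\<integral>x. \<phi> x * rderiv w b x \<partial>lborel)"
      by (rule integral_rderiv_test_function[OF lip sc b \<phi>])
    also have "\<dots> = - (\<integral>x. \<phi> x *\<^sub>R rgrad w x \<partial>lborel) \<bullet> b"
      using integral_inner_left[OF int2, of b] b by (simp add: rgrad_inner)
    finally show "(\<integral>x. w x *\<^sub>R grad \<phi> x \<partial>lborel) \<bullet> b = - (\<integral>x. \<phi> x *\<^sub>R rgrad w x \<partial>lborel) \<bullet> b" .
  qed
  moreover have "(\<lambda>x. w x *\<^sub>R grad \<phi> x) \<in> borel_measurable lborel"
    "(\<lambda>x. \<phi> x *\<^sub>R rgrad w x) \<in> borel_measurable lborel"
    using int1 int2 by auto
  ultimately show "(\<integral>x. w x *\<^sub>R grad \<phi> x \<partial>lebesgue) = - (\<integral>x. \<phi> x *\<^sub>R rgrad w x \<partial>lebesgue)"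
    by (simp only: integral_completion)
qed

section \<open>Uniform convergence of semiconcave functions\<close>

text \<open>
  A Lipschitz cutoff function: it is \<open>1\<close> on the ball of radius \<open>r\<close> and \<open>0\<close> outside the ball of
  radius \<open>r + 1\<close>.
\<close>

definition cutoff :: "real \<Rightarrow> 'a::euclidean_space \<Rightarrow> real" where
  "cutoff r x = max 0 (min 1 (r + 1 - norm x))"

lemma abs_cutoff_diff_le: "\<bar>cutoff r x - cutoff r y\<bar> \<le> norm (x - y)"
  using norm_triangle_sub[of x y] norm_triangle_sub[of y x] norm_minus_commute[of x y]
  unfolding cutoff_def by linarith

lemma continuous_cutoff: "continuous_on A (cutoff r)"
  unfolding cutoff_def by (intro continuous_intros)

lemma cutoff_nonneg: "0 \<le> cutoff r x" and cutoff_le_1: "cutoff r x \<le> 1"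
  by (auto simp: cutoff_def)

lemma cutoff_eq_0: "r + 1 \<le> norm x \<Longrightarrow> cutoff r x = 0"
  and cutoff_eq_1: "norm x \<le> r \<Longrightarrow> cutoff r x = 1"
  by (auto simp: cutoff_def)

text \<open>
  The backward quotient at \<open>x\<close> is the forward quotient at \<open>x - h b\<close>. After translation the difference
  falls on the cutoff function, which changes by at most \<open>h\<close>, while the quotient is bounded by \<open>M\<close>.
\<close>

lemma integral_cutoff_quotient_gap_le:
  fixes w :: "'a::euclidean_space \<Rightarrow> real"
  assumes lip: "M-lipschitz_on UNIV w" and b: "b \<in> Basis" and h: "0 < h" "h \<le> 1"
  shows "(\<integral>x. cutoff r x * ((w x - w (x - h *\<^sub>R b)) / h - (w (x + h *\<^sub>R b) - w x) / h) \<partial>lborel)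
    \<le> M * h * measure lborel (cball 0 (r + 2) :: 'a set)"
proof -
  define \<psi> where "\<psi> = (cutoff r :: 'a \<Rightarrow> real)"
  define q where "q x = (w (x + h *\<^sub>R b) - w x) / h" for x
  note cw = lipschitz_on_continuous_on[OF lip]
  have c\<psi>: "continuous_on A \<psi>" for A unfolding \<psi>_def by (rule continuous_cutoff)
  have zero: "\<psi> x = 0" if "r + 1 \<le> norm x" for x using that by (simp add: \<psi>_def cutoff_eq_0)
  have ctrans: "continuous_on UNIV (\<lambda>x. w (x + c))" "continuous_on UNIV (\<lambda>x. w (x - c))"
    "continuous_on UNIV (\<lambda>x. \<psi> (x + c))" for c :: 'a
    by (auto intro!: continuous_on_compose2[OF cw] continuous_on_compose2[OF c\<psi>[of UNIV]] continuous_intros)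
  have cq: "continuous_on UNIV q" "continuous_on UNIV (\<lambda>x. q (x - h *\<^sub>R b))"
    using h by (auto simp: q_def intro!: continuous_intros ctrans cw)
  have zero': "\<psi> (x + h *\<^sub>R b) = 0" if "r + 2 < norm x" for x
  proof -
    have "norm x \<le> norm (x + h *\<^sub>R b) + norm (h *\<^sub>R b)"
      using norm_triangle_ineq4[of "x + h *\<^sub>R b" "h *\<^sub>R b"] by simp
    then show ?thesis using that b h by (intro zero) simp
  qed
  have int: "integrable lborel (\<lambda>x. \<psi> x * q x)" "integrable lborel (\<lambda>x. \<psi> x * q (x - h *\<^sub>R b))"
    "integrable lborel (\<lambda>x. \<psi> (x + h *\<^sub>R b) * q x)"
    using zero zero'
    by (auto intro!: integrable_continuous_bounded_support[of _ "r + 2"] continuous_intros c\<psi> cq ctrans)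
  have "(\<integral>x. \<psi> (x + h *\<^sub>R b) * q ((x + h *\<^sub>R b) - h *\<^sub>R b) \<partial>lborel) = (\<integral>x. \<psi> x * q (x - h *\<^sub>R b) \<partial>lborel)"
    by (rule integral_lborel_translate[of "\<lambda>x. \<psi> x * q (x - h *\<^sub>R b)"])
      (intro borel_measurable_continuous_onI continuous_intros c\<psi> cq)
  then have shift: "(\<integral>x. \<psi> x * q (x - h *\<^sub>R b) \<partial>lborel) = (\<integral>x. \<psi> (x + h *\<^sub>R b) * q x \<partial>lborel)"
    by simp
  have "(\<integral>x. \<psi> x * ((w x - w (x - h *\<^sub>R b)) / h - (w (x + h *\<^sub>R b) - w x) / h) \<partial>lborel)
      = (\<integral>x. \<psi> x * q (x - h *\<^sub>R b) - \<psi> x * q x \<partial>lborel)"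
    by (simp add: q_def right_diff_distrib)
  also have "\<dots> = (\<integral>x. \<psi> (x + h *\<^sub>R b) * q x \<partial>lborel) - (\<integral>x. \<psi> x * q x \<partial>lborel)"
    using int shift by simp
  also have "\<dots> = (\<integral>x. (\<psi> (x + h *\<^sub>R b) - \<psi> x) * q x \<partial>lborel)"
    using int by (simp add: left_diff_distrib)
  also have "\<dots> \<le> (\<integral>x. indicator (cball 0 (r + 2)) x *\<^sub>R (M * h) \<partial>(lborel :: 'a measure))"
  proof (rule integral_mono)
    show "integrable lborel (\<lambda>x. (\<psi> (x + h *\<^sub>R b) - \<psi> x) * q x)"
      using int by (simp add: left_diff_distrib)
    show "integrable lborel (\<lambda>x::'a. indicator (cball 0 (r + 2)) x *\<^sub>R (M * h))"
      by (intro borel_integrable_compact) auto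
    fix x
    show "(\<psi> (x + h *\<^sub>R b) - \<psi> x) * q x \<le> indicator (cball 0 (r + 2)) x *\<^sub>R (M * h)"
    proof (cases "norm x \<le> r + 2")
      case True
      have "\<bar>(\<psi> (x + h *\<^sub>R b) - \<psi> x) * q x\<bar> \<le> h * M"
        unfolding abs_mult
        using abs_cutoff_diff_le[of r "x + h *\<^sub>R b" x] lipschitz_quotient_bound[OF lip b h(1), of x] b h
        by (intro mult_mono) (auto simp: \<psi>_def q_def)
      with True show ?thesis by (simp add: mult.commute)
    next
      case False
      with zero[of x] zero'[of x] show ?thesis by simp
    qed
  qed
  also have "\<dots> = M * h * measure lborel (cball 0 (r + 2) :: 'a set)" by simp
  finally show ?thesis by (simp add: \<psi>_def)
qed

text \<open>
  The derivatives of \<open>v\<close> and \<open>w\<close> both lie between their forward and backward quotients up to \<open>2 \<epsilon>\<close>,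
  and corresponding quotients of \<open>v\<close> and \<open>w\<close> differ by at most \<open>2 \<eta> / h\<close>. So their distance is at most
  the quotient gap of \<open>w\<close> alone plus a constant, and this sum is nonnegative everywhere.
\<close>

lemma integral_abs_rderiv_diff_le:
  fixes v w :: "'a::euclidean_space \<Rightarrow> real"
  assumes v: "M-lipschitz_on UNIV v" "uniformly_semiconcave \<delta> v"
    and w: "M-lipschitz_on UNIV w" "uniformly_semiconcave \<delta> w"
    and b: "b \<in> Basis" and \<epsilon>: "0 < \<epsilon>" and h: "0 < h" "h \<le> 1" "h \<le> \<delta> \<epsilon>"
    and r: "0 \<le> r" and close: "\<And>x. norm x \<le> r + 1 \<Longrightarrow> \<bar>v x - w x\<bar> \<le> \<eta>"
  shows "(\<integral>x. indicator (cball 0 r) x * \<bar>rderiv v b x - rderiv w b x\<bar> \<partial>lborel)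
    \<le> (4 * \<epsilon> + 2 * \<eta> / h + M * h) * measure lborel (cball 0 (r + 2) :: 'a set)"
proof -
  define fwd where "fwd u x = (u (x + h *\<^sub>R b) - u x) / h" for u and x :: 'a
  define bwd where "bwd u x = (u x - u (x - h *\<^sub>R b)) / h" for u and x :: 'a
  define c where "c = 4 * \<epsilon> + 2 * \<eta> / h"
  have bounds: "fwd u x \<le> rderiv u b x + 2 * \<epsilon>" "rderiv u b x \<le> bwd u x + 2 * \<epsilon>"
    if "M-lipschitz_on UNIV u" "uniformly_semiconcave \<delta> u" for u x
    using forward_quotient_le_rderiv[OF that b \<epsilon> h(1,3)] rderiv_le_backward_quotient[OF that b \<epsilon> h(1,3)]
    by (auto simp: fwd_def bwd_def)
  have pt: "\<bar>rderiv v b x - rderiv w b x\<bar> \<le> bwd w x - fwd w x + c" if "norm x \<le> r" for x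
  proof -
    have "norm (x + h *\<^sub>R b) \<le> r + 1" "norm (x - h *\<^sub>R b) \<le> r + 1"
      using norm_triangle_ineq[of x "h *\<^sub>R b"] norm_triangle_ineq4[of x "h *\<^sub>R b"] that b h by auto
    then have "\<bar>v (x + h *\<^sub>R b) - w (x + h *\<^sub>R b)\<bar> \<le> \<eta>" "\<bar>v x - w x\<bar> \<le> \<eta>"
      "\<bar>v (x - h *\<^sub>R b) - w (x - h *\<^sub>R b)\<bar> \<le> \<eta>"
      using close that by auto
    then have "h * bwd v x \<le> h * bwd w x + 2 * \<eta>" "h * fwd w x \<le> h * fwd v x + 2 * \<eta>"
      using h(1) by (auto simp: bwd_def fwd_def)
    then have "bwd v x \<le> bwd w x + 2 * \<eta> / h" "fwd w x \<le> fwd v x + 2 * \<eta> / h"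
      using h(1) by (simp_all add: field_simps)
    then show ?thesis
      using bounds[OF v, of x] bounds[OF w, of x] unfolding c_def by linarith
  qed
  have "0 \<le> \<eta>" using close[of 0] r by force
  then have c: "4 * \<epsilon> \<le> c" using h by (simp add: c_def)
  have gap: "0 \<le> bwd w x - fwd w x + c" for x
    using bounds[OF w, of x] c by linarith
  have cont: "continuous_on UNIV (\<lambda>x. bwd w x - fwd w x)"
    using h unfolding bwd_def fwd_def
    by (auto intro!: continuous_intros continuous_on_compose2[OF lipschitz_on_continuous_on[OF w(1)]])
  have int: "integrable lborel (\<lambda>x. cutoff r x * (bwd w x - fwd w x))"
    "integrable lborel (\<lambda>x::'a. cutoff r x * c)"
    by (auto intro!: integrable_continuous_bounded_support[of _ "r + 1"] continuous_intros
        continuous_cutoff cont simp: cutoff_eq_0)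
  have "(\<integral>x. indicator (cball 0 r) x * \<bar>rderiv v b x - rderiv w b x\<bar> \<partial>lborel)
      \<le> (\<integral>x. cutoff r x * (bwd w x - fwd w x) + cutoff r x * c \<partial>lborel)"
  proof (rule integral_mono')
    show "integrable lborel (\<lambda>x. cutoff r x * (bwd w x - fwd w x) + cutoff r x * c)"
      using int by (rule Bochner_Integration.integrable_add)
    have nonneg: "0 \<le> cutoff r x * (bwd w x - fwd w x + c)" for x
      by (rule mult_nonneg_nonneg[OF cutoff_nonneg gap])
    then show "0 \<le> cutoff r x * (bwd w x - fwd w x) + cutoff r x * c" for x
      by (simp only: distrib_left)
    have "indicator (cball 0 r) x * \<bar>rderiv v b x - rderiv w b x\<bar> \<le> cutoff r x * (bwd w x - fwd w x + c)" for x
      using pt[of x] nonneg[of x] by (auto simp: indicator_def cutoff_eq_1)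
    then show "indicator (cball 0 r) x * \<bar>rderiv v b x - rderiv w b x\<bar>
        \<le> cutoff r x * (bwd w x - fwd w x) + cutoff r x * c" for x
      by (simp only: distrib_left)
  qed
  also have "\<dots> = (\<integral>x. cutoff r x * (bwd w x - fwd w x) \<partial>lborel) + (\<integral>x. cutoff r x * c \<partial>(lborel :: 'a measure))"
    using int by (rule Bochner_Integration.integral_add)
  also have "(\<integral>x. cutoff r x * (bwd w x - fwd w x) \<partial>lborel)
      \<le> M * h * measure lborel (cball 0 (r + 2) :: 'a set)"
    unfolding bwd_def fwd_def by (rule integral_cutoff_quotient_gap_le[OF w(1) b h(1,2)])
  also have "(\<integral>x. cutoff r x * c \<partial>(lborel :: 'a measure)) \<le> (\<integral>x. indicator (cball 0 (r + 2)) x *\<^sub>R c \<partial>(lborel :: 'a measure))"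
  proof (rule integral_mono')
    show "integrable lborel (\<lambda>x::'a. indicator (cball 0 (r + 2)) x *\<^sub>R c)"
      by (intro borel_integrable_compact) auto
    show "cutoff r x * c \<le> indicator (cball 0 (r + 2)) x *\<^sub>R c"
      and "0 \<le> indicator (cball 0 (r + 2)) x *\<^sub>R c" for x :: 'a
      using c \<epsilon> cutoff_le_1[of r x] cutoff_eq_0[of r x]
      by (auto simp: indicator_def mult_left_le_one_le cutoff_nonneg)
  qed
  also have "\<dots> = c * measure lborel (cball 0 (r + 2) :: 'a set)" by simp
  finally show ?thesis by (simp add: c_def algebra_simps)
qed

section \<open>Linearity of the weak gradient\<close>

lemma integrable_mult_locally_integrable:
  fixes F :: "'a::euclidean_space \<Rightarrow> 'b::euclidean_space" and \<phi> :: "'a \<Rightarrow> real"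
  assumes \<phi>: "continuous_on UNIV \<phi>" and supp: "\<And>x. r < norm x \<Longrightarrow> \<phi> x = 0"
    and F: "locally_integrable F"
  shows "integrable lebesgue (\<lambda>x. \<phi> x *\<^sub>R F x)"
proof -
  have "bounded (\<phi> ` cball 0 r)"
    by (intro compact_imp_bounded compact_continuous_image continuous_on_subset[OF \<phi>]) auto
  then obtain C where C: "0 < C" "\<And>x. norm x \<le> r \<Longrightarrow> \<bar>\<phi> x\<bar> \<le> C" by (auto simp: bounded_pos)
  have int: "integrable lebesgue (\<lambda>x. indicator (cball 0 r) x *\<^sub>R F x)"
    using F unfolding locally_integrable_def set_integrable_def by simp
  have "integrable lebesgue (\<lambda>x. \<phi> x *\<^sub>R indicator (cball 0 r) x *\<^sub>R F x)"
  proof (rule Bochner_Integration.integrable_bound)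
    show "integrable lebesgue (\<lambda>x. C *\<^sub>R indicator (cball 0 r) x *\<^sub>R F x)" using int by (rule integrable_scaleR_right)
    have "\<phi> \<in> borel_measurable lebesgue"
      using borel_measurable_continuous_onI[OF \<phi>] by (intro measurable_completion) simp
    then show "(\<lambda>x. \<phi> x *\<^sub>R indicator (cball 0 r) x *\<^sub>R F x) \<in> borel_measurable lebesgue"
      by (rule borel_measurable_scaleR[OF _ borel_measurable_integrable[OF int]])
    show "AE x in lebesgue. norm (\<phi> x *\<^sub>R indicator (cball 0 r) x *\<^sub>R F x)
        \<le> norm (C *\<^sub>R indicator (cball 0 r) x *\<^sub>R F x)"
      using C by (intro AE_I2) (auto simp: indicator_def intro!: mult_right_mono)
  qed
  moreover have "(\<lambda>x. \<phi> x *\<^sub>R indicator (cball 0 r) x *\<^sub>R F x) = (\<lambda>x. \<phi> x *\<^sub>R F x)"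
    using supp by (auto simp: fun_eq_iff indicator_def) (meson not_le)
  ultimately show ?thesis by simp
qed

lemma integrable_test_function:
  assumes \<phi>: "test_function \<phi>"
  shows "locally_integrable F \<Longrightarrow> integrable lebesgue (\<lambda>x. \<phi> x *\<^sub>R F x)"
    and "locally_integrable f \<Longrightarrow> integrable lebesgue (\<lambda>x. f x *\<^sub>R grad \<phi> x)"
proof -
  obtain r where r: "\<And>x. r < norm x \<Longrightarrow> \<phi> x = 0 \<and> grad \<phi> x = 0"
    using test_function_support[OF \<phi>] by blast
  show "integrable lebesgue (\<lambda>x. \<phi> x *\<^sub>R F x)" if "locally_integrable F"
    using r by (intro integrable_mult_locally_integrable[OF continuous_test_function[OF \<phi>] _ that]) auto
  show "integrable lebesgue (\<lambda>x. f x *\<^sub>R grad \<phi> x)" if f: "locally_integrable f"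
  proof -
    have "integrable lebesgue (\<lambda>x. (grad \<phi> x \<bullet> b) *\<^sub>R f x)" for b
      using r by (intro integrable_mult_locally_integrable[OF _ _ f, of _ r] continuous_intros
          continuous_grad_test_function[OF \<phi>]) auto
    then have "integrable lebesgue (\<lambda>x. \<Sum>b\<in>Basis. ((grad \<phi> x \<bullet> b) *\<^sub>R f x) *\<^sub>R b)"
      by (intro Bochner_Integration.integrable_sum integrable_scaleR_left)
    moreover have "(\<Sum>b\<in>Basis. ((grad \<phi> x \<bullet> b) *\<^sub>R f x) *\<^sub>R b) = f x *\<^sub>R grad \<phi> x" for x
    proof -
      have "f x *\<^sub>R grad \<phi> x = f x *\<^sub>R (\<Sum>b\<in>Basis. (grad \<phi> x \<bullet> b) *\<^sub>R b)"
        by (simp only: euclidean_representation)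
      then show ?thesis by (simp add: scaleR_sum_right mult.commute)
    qed
    ultimately show ?thesis by simp
  qed
qed

lemma locally_integrable_add:
  "locally_integrable f \<Longrightarrow> locally_integrable g \<Longrightarrow> locally_integrable (\<lambda>x. f x + g x)"
  unfolding locally_integrable_def by (auto intro: set_integral_add(1))

lemma locally_integrable_minus:
  "locally_integrable f \<Longrightarrow> locally_integrable (\<lambda>x. - f x)"
  unfolding locally_integrable_def set_integrable_def by simp

lemma weak_gradient_add:
  assumes f: "weak_gradient f F" and g: "weak_gradient g G"
  shows "weak_gradient (\<lambda>x. f x + g x) (\<lambda>x. F x + G x)"
proof -
  have loc: "locally_integrable f" "locally_integrable F" "locally_integrable g" "locally_integrable G"
    using f g by (auto simp: weak_gradient_def)
  have "(\<integral>x. (f x + g x) *\<^sub>R grad \<phi> x \<partial>lebesgue) = - (\<integral>x. \<phi> x *\<^sub>R (F x + G x) \<partial>lebesgue)"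
    if \<phi>: "test_function \<phi>" for \<phi>
    using f g \<phi> integrable_test_function(1)[OF \<phi> loc(2)] integrable_test_function(1)[OF \<phi> loc(4)]
      integrable_test_function(2)[OF \<phi> loc(1)] integrable_test_function(2)[OF \<phi> loc(3)]
    by (simp add: weak_gradient_def scaleR_add_left scaleR_add_right)
  then show ?thesis using loc by (simp add: weak_gradient_def locally_integrable_add)
qed

lemma weak_gradient_minus:
  assumes f: "weak_gradient f F"
  shows "weak_gradient (\<lambda>x. - f x) (\<lambda>x. - F x)"
  using f by (simp add: weak_gradient_def locally_integrable_minus)

lemma weak_gradient_diff:
  assumes "weak_gradient f F" "weak_gradient g G"
  shows "weak_gradient (\<lambda>x. f x - g x) (\<lambda>x. F x - G x)"
  using weak_gradient_add[OF assms(1) weak_gradient_minus[OF assms(2)]] by simp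

section \<open>The topology of the local Sobolev space\<close>

lemma W11_ball_self:
  assumes "f \<in> W11_loc" "0 < e"
  shows "f \<in> W11_ball K f e"
proof -
  have "locally_integrable (\<lambda>x::'a. 0::'b::euclidean_space)"
    by (rule locally_integrable_continuous) simp
  then have "weak_gradient (\<lambda>x. f x - f x) (\<lambda>x. 0)"
    using locally_integrable_continuous[of "\<lambda>x. 0::real"] locally_integrable_continuous[of "\<lambda>x. 0::'a"]
    by (simp add: weak_gradient_def)
  then show ?thesis
    using assms by (auto simp: W11_ball_def intro!: exI[of _ "\<lambda>x. 0"])
qed

lemma W11_ball_sym:
  assumes "g \<in> W11_ball K f e" "f \<in> W11_loc"
  shows "f \<in> W11_ball K g e"
proof -
  obtain G where "weak_gradient (\<lambda>x. g x - f x) G"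
    "(LINT x:K|lebesgue. \<bar>g x - f x\<bar>) + (LINT x:K|lebesgue. norm (G x)) < e"
    using assms(1) by (auto simp: W11_ball_def)
  then show ?thesis
    using assms(2) weak_gradient_minus[of "\<lambda>x. g x - f x" G]
    by (auto simp: W11_ball_def abs_minus_commute intro!: exI[of _ "\<lambda>x. - G x"])
qed

lemma set_integral_norm_add_le:
  fixes F G :: "'a::euclidean_space \<Rightarrow> 'b::euclidean_space"
  assumes "locally_integrable F" "locally_integrable G" "compact K"
  shows "(LINT x:K|lebesgue. norm (F x + G x))
    \<le> (LINT x:K|lebesgue. norm (F x)) + (LINT x:K|lebesgue. norm (G x))"
proof -
  have int: "set_integrable lebesgue K (\<lambda>x. norm (F x))" "set_integrable lebesgue K (\<lambda>x. norm (G x))"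
    "set_integrable lebesgue K (\<lambda>x. norm (F x + G x))"
    using assms locally_integrable_add[OF assms(1,2)]
    by (auto simp: locally_integrable_def intro: set_integrable_norm)
  have "(LINT x:K|lebesgue. norm (F x + G x)) \<le> (LINT x:K|lebesgue. norm (F x) + norm (G x))"
    by (rule set_integral_mono[OF int(3) set_integral_add(1)[OF int(1,2)] norm_triangle_ineq])
  also have "\<dots> = (LINT x:K|lebesgue. norm (F x)) + (LINT x:K|lebesgue. norm (G x))"
    by (rule set_integral_add(2)[OF int(1,2)])
  finally show ?thesis .
qed

text \<open>
  Two forms of the triangle inequality. The first says that a ball is a neighbourhood of each of its
  points; it is read off from one weak gradient \<open>G\<close> that witnesses membership of \<open>g\<close>.
\<close>

lemma W11_ball_triangle:
  assumes "g \<in> W11_ball K f e" "compact K"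
  shows "\<exists>d>0. W11_ball K g d \<subseteq> W11_ball K f e"
    and "k \<in> W11_ball K g d \<Longrightarrow> k \<in> W11_ball K f (e + d)"
proof -
  obtain G where G: "weak_gradient (\<lambda>x. g x - f x) G"
    and lt: "(LINT x:K|lebesgue. \<bar>g x - f x\<bar>) + (LINT x:K|lebesgue. norm (G x)) < e"
    using assms(1) by (auto simp: W11_ball_def)
  define a where "a = (LINT x:K|lebesgue. \<bar>g x - f x\<bar>) + (LINT x:K|lebesgue. norm (G x))"
  have *: "k \<in> W11_ball K f (a + d)" if "k \<in> W11_ball K g d" for k d
  proof -
    have "k \<in> W11_loc" and "\<exists>F. weak_gradient (\<lambda>x. k x - g x) F \<and>
        (LINT x:K|lebesgue. \<bar>k x - g x\<bar>) + (LINT x:K|lebesgue. norm (F x)) < d"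
      using that by (auto simp: W11_ball_def)
    then obtain F where k: "k \<in> W11_loc" and F: "weak_gradient (\<lambda>x. k x - g x) F"
      and lt: "(LINT x:K|lebesgue. \<bar>k x - g x\<bar>) + (LINT x:K|lebesgue. norm (F x)) < d"
      by blast
    have loc: "locally_integrable (\<lambda>x. k x - g x)" "locally_integrable (\<lambda>x. g x - f x)"
      "locally_integrable F" "locally_integrable G"
      using F G by (auto simp: weak_gradient_def)
    have "weak_gradient (\<lambda>x. k x - f x) (\<lambda>x. F x + G x)"
      using weak_gradient_add[OF F G] by simp
    moreover have "(LINT x:K|lebesgue. \<bar>k x - f x\<bar>) + (LINT x:K|lebesgue. norm (F x + G x)) < a + d"
      using set_integral_norm_add_le[OF loc(1,2) assms(2)] set_integral_norm_add_le[OF loc(3,4) assms(2)] lt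
      by (simp add: a_def)
    ultimately show ?thesis using k by (auto simp: W11_ball_def)
  qed
  from *[of _ "e - a"] lt show "\<exists>d>0. W11_ball K g d \<subseteq> W11_ball K f e"
    by (intro exI[of _ "e - a"]) (auto simp: a_def)
  assume "k \<in> W11_ball K g d"
  from *[OF this] lt show "k \<in> W11_ball K f (e + d)"
    using W11_ball_mono[OF assms(2,2) order_refl, of "a + d" "e + d" f] by (auto simp: a_def)
qed

lemma openin_W11_ball:
  assumes "compact K"
  shows "openin W11_loc_topology (W11_ball K f e)"
  unfolding openin_W11_loc_topology
proof (intro conjI ballI)
  show "W11_ball K f e \<subseteq> W11_loc" by (auto simp: W11_ball_def)
  fix g assume "g \<in> W11_ball K f e"
  from W11_ball_triangle(1)[OF this assms] assms
  show "\<exists>K' d. compact K' \<and> 0 < d \<and> W11_ball K' g d \<subseteq> W11_ball K f e" by blast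
qed

lemma regular_space_W11_loc: "regular_space W11_loc_topology"
  unfolding neighbourhood_base_of_closedin[symmetric] neighbourhood_base_of
proof (intro allI impI)
  fix W :: "('a \<Rightarrow> real) set" and f
  assume W: "openin W11_loc_topology W \<and> f \<in> W"
  then obtain K e where K: "compact K" "0 < e" "W11_ball K f e \<subseteq> W" and f: "f \<in> W11_loc"
    unfolding openin_W11_loc_topology by blast
  define U where "U = W11_ball K f (e / 2)"
  have U: "openin W11_loc_topology U" "f \<in> U"
    using K f by (auto simp: U_def openin_W11_ball W11_ball_self)
  have "W11_loc_topology closure_of U \<subseteq> W11_ball K f e"
  proof
    fix g assume g: "g \<in> W11_loc_topology closure_of U"
    then have "g \<in> W11_loc" by (simp add: in_closure_of topspace_W11_loc_topology)
    then have "g \<in> W11_ball K g (e / 2)" using K by (intro W11_ball_self) auto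
    then obtain k where k: "k \<in> U" "k \<in> W11_ball K g (e / 2)"
      using g openin_W11_ball[OF K(1), of g "e / 2"] unfolding in_closure_of by blast
    from W11_ball_triangle(2)[OF k(1)[unfolded U_def] K(1) W11_ball_sym[OF k(2) \<open>g \<in> W11_loc\<close>]]
    show "g \<in> W11_ball K f e" by simp
  qed
  then show "\<exists>U V. openin W11_loc_topology U \<and> closedin W11_loc_topology V \<and> f \<in> U \<and> U \<subseteq> V \<and> V \<subseteq> W"
    using U K(3) openin_subset[OF U(1)]
    by (intro exI[of _ U] exI[of _ "W11_loc_topology closure_of U"]) (auto simp: closure_of_subset)
qed

text \<open>
  The space need not be Hausdorff, so a compact set need not be closed. In a regular space, however, every
  open set that contains a compact set also contains its closure.
\<close>

lemma compactin_closure_of_regular: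
  assumes X: "regular_space X" and S: "compactin X S"
  shows "compactin X (X closure_of S)"
  unfolding compactin_def
proof (intro conjI allI impI)
  fix \<U> assume \<U>: "Ball \<U> (openin X) \<and> X closure_of S \<subseteq> \<Union>\<U>"
  have "S \<subseteq> X closure_of S" using S by (intro closure_of_subset compactin_subset_topspace)
  then obtain \<F> where \<F>: "finite \<F>" "\<F> \<subseteq> \<U>" "S \<subseteq> \<Union>\<F>"
    using S \<U> unfolding compactin_def by (meson subset_trans)
  have "openin X (\<Union>\<F>)" using \<U> \<F>(2) by (intro openin_Union) blast
  then have "closedin X (topspace X - \<Union>\<F>)" by blast
  moreover have "disjnt S (topspace X - \<Union>\<F>)" using \<F>(3) by (auto simp: disjnt_def)
  ultimately have "\<exists>U V. openin X U \<and> openin X V \<and> S \<subseteq> U \<and> topspace X - \<Union>\<F> \<subseteq> V \<and> disjnt U V"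
    by (rule regular_space_compact_closed_separation[OF X S])
  then obtain U V where UV: "openin X U" "openin X V" "S \<subseteq> U" "topspace X - \<Union>\<F> \<subseteq> V" "disjnt U V"
    by (elim exE conjE)
  have "X closure_of S \<subseteq> topspace X - V"
    using UV by (intro closure_of_minimal) (auto simp: disjnt_def dest: openin_subset)
  then have "X closure_of S \<subseteq> \<Union>\<F>" using UV(4) by blast
  then show "\<exists>\<F>. finite \<F> \<and> \<F> \<subseteq> \<U> \<and> X closure_of S \<subseteq> \<Union>\<F>" using \<F> by blast
qed (rule closure_of_subset_topspace)

lemma relatively_compact_in_subset:
  assumes "regular_space X" "compactin X C" "S \<subseteq> C"
  shows "relatively_compact_in X S"
proof -
  have "X closure_of S \<subseteq> X closure_of C" by (rule closure_of_mono[OF assms(3)])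
  then have "compactin X (X closure_of S)"
    by (rule closed_compactin[OF compactin_closure_of_regular[OF assms(1,2)]]) simp
  then show ?thesis
    using assms(2,3) compactin_subset_topspace unfolding relatively_compact_in_def by blast
qed

section \<open>Compactness\<close>

text \<open>
  Within the \<open>M\<close>-Lipschitz functions with semiconcavity modulus \<open>\<delta>\<close>, uniform closeness on a large ball
  implies closeness in the local Sobolev space.
\<close>

lemma uniformly_close_in_W11_ball:
  fixes K :: "'a::euclidean_space set"
  assumes K: "compact K" and e: "0 < e" and M: "0 \<le> M"
  shows "\<exists>r. \<exists>\<eta>>0. \<forall>v w. M-lipschitz_on UNIV v \<longrightarrow> uniformly_semiconcave \<delta> v \<longrightarrow>
    M-lipschitz_on UNIV w \<longrightarrow> uniformly_semiconcave \<delta> w \<longrightarrow>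
    (\<forall>x\<in>cball 0 r. \<bar>v x - w x\<bar> \<le> \<eta>) \<longrightarrow> v \<in> W11_ball K w e"
  \<comment> \<open>If no function has modulus \<open>\<delta>\<close> there is nothing to prove; otherwise \<open>\<delta>\<close> is positive.\<close>
proof (cases "\<exists>w :: 'a \<Rightarrow> real. uniformly_semiconcave \<delta> w")
  case True
  then have \<delta>: "0 < \<delta> \<epsilon>" if "0 < \<epsilon>" for \<epsilon> using that by (auto simp: uniformly_semiconcave_def)
  obtain r where r: "0 < r" "K \<subseteq> cball 0 r"
    using compact_imp_bounded[OF K] by (auto simp: bounded_pos subset_iff)
  define c where "c = measure lborel (cball 0 (r + 2) :: 'a set)"
  \<comment> \<open>First \<open>\<epsilon>\<close> is chosen, then the step \<open>h\<close>, then \<open>\<eta>\<close>, so that each of the three terms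
    \<open>4 \<epsilon>\<close>, \<open>M h\<close>, \<open>2 \<eta> / h\<close> is at most \<open>e / (4 A)\<close>; the factor \<open>A\<close> exceeds the volume times the number
    of integrals to be estimated, one for the values and one for each partial derivative.\<close>
  define A where "A = (real DIM('a) + 1) * c + 1"
  define \<epsilon> where "\<epsilon> = e / (16 * A)"
  define h where "h = min (min 1 (\<delta> \<epsilon>)) (e / (4 * A) / (M + 1))"
  define \<eta> where "\<eta> = h * e / (16 * A)"
  have c: "0 \<le> c" by (simp add: c_def)
  then have A: "0 < A" by (simp add: A_def add_nonneg_pos)
  have \<epsilon>: "0 < \<epsilon>" using e A by (simp add: \<epsilon>_def)
  have h: "0 < h" "h \<le> 1" "h \<le> \<delta> \<epsilon>" using e A M \<delta>[OF \<epsilon>] by (auto simp: h_def)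
  have \<eta>: "0 < \<eta>" using h e A by (simp add: \<eta>_def)
  have "\<eta> \<le> e / (16 * A)"
    using h e A unfolding \<eta>_def by (intro divide_right_mono) auto
  moreover have "e / (16 * A) \<le> 3 / 4 * (e / A)" using e A by (simp add: field_simps)
  ultimately have small_\<eta>: "\<eta> \<le> 3 / 4 * (e / A)" by (rule order_trans)
  have "h \<le> e / (4 * A) / (M + 1)" unfolding h_def by (rule min.cobounded2)
  then have "(M + 1) * h \<le> e / (4 * A)" using M by (simp only: pos_le_divide_eq mult.commute)
  moreover have "M * h \<le> (M + 1) * h" using h by simp
  ultimately have "M * h \<le> e / (4 * A)" by linarith
  moreover have "4 * \<epsilon> = e / (4 * A)" "2 * \<eta> / h = e / (8 * A)"
    using h by (auto simp: \<epsilon>_def \<eta>_def)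
  ultimately have small: "4 * \<epsilon> + 2 * \<eta> / h + M * h \<le> 3 / 4 * (e / A)"
    using divide_pos_pos[OF e A] by simp
  have "v \<in> W11_ball K w e"
    if v: "M-lipschitz_on UNIV v" "uniformly_semiconcave \<delta> v"
      and w: "M-lipschitz_on UNIV w" "uniformly_semiconcave \<delta> w"
      and close: "\<forall>x\<in>cball 0 (r + 1). \<bar>v x - w x\<bar> \<le> \<eta>" for v w
  proof -
    define G where "G x = rgrad v x - rgrad w x" for x
    have wv: "weak_gradient v (rgrad v)" by (rule weak_gradient_rgrad[OF v])
    have G: "weak_gradient (\<lambda>x. v x - w x) G"
      unfolding G_def by (rule weak_gradient_diff[OF wv weak_gradient_rgrad[OF w]])
    have [measurable]: "v \<in> borel_measurable borel" "w \<in> borel_measurable borel" "K \<in> sets borel"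
      using K by (auto simp: compact_imp_closed intro!: borel_measurable_continuous_onI
          lipschitz_on_continuous_on[OF v(1)] lipschitz_on_continuous_on[OF w(1)])
    have dmeas: "(\<lambda>x. \<bar>rderiv v b x - rderiv w b x\<bar>) \<in> borel_measurable borel" if "b \<in> Basis" for b
      using borel_measurable_rderiv[OF v that] borel_measurable_rderiv[OF w that] by simp
    have Gmeas [measurable]: "G \<in> borel_measurable borel"
      using borel_measurable_rderiv[OF v] borel_measurable_rderiv[OF w] unfolding G_def rgrad_def
      by (intro borel_measurable_diff borel_measurable_sum borel_measurable_scaleR) auto
    have "(LINT x:K|lebesgue. \<bar>v x - w x\<bar>) = (\<integral>x. indicator K x *\<^sub>R \<bar>v x - w x\<bar> \<partial>lborel)"
      unfolding set_lebesgue_integral_def by (rule integral_completion) measurable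
    also have "\<dots> \<le> (\<integral>x. indicator (cball 0 (r + 2)) x *\<^sub>R \<eta> \<partial>(lborel :: 'a measure))"
    proof (rule integral_mono')
      show "integrable lborel (\<lambda>x::'a. indicator (cball 0 (r + 2)) x *\<^sub>R \<eta>)"
        by (intro borel_integrable_compact) auto
      show "indicator K x *\<^sub>R \<bar>v x - w x\<bar> \<le> indicator (cball 0 (r + 2)) x *\<^sub>R \<eta>"
        and "0 \<le> indicator (cball 0 (r + 2)) x *\<^sub>R \<eta>" for x
        using close r \<eta> by (auto simp: indicator_def subset_iff)
    qed
    also have "\<dots> = \<eta> * c" by (simp add: c_def)
    also have "\<dots> \<le> 3 / 4 * (e / A) * c" using small_\<eta> c by (intro mult_right_mono)
    finally have int_value: "(LINT x:K|lebesgue. \<bar>v x - w x\<bar>) \<le> 3 / 4 * (e / A) * c" .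
    have intd: "integrable lborel (\<lambda>x. indicator (cball 0 r) x *\<^sub>R \<bar>rderiv v b x - rderiv w b x\<bar>)"
      if b: "b \<in> Basis" for b
    proof (rule integrable_indicator_bounded[OF dmeas[OF b]])
      show "norm \<bar>rderiv v b x - rderiv w b x\<bar> \<le> 2 * M" for x
        using abs_rderiv_le[OF v b, of x] abs_rderiv_le[OF w b, of x] by simp
    qed simp
    have "(LINT x:K|lebesgue. norm (G x)) = (\<integral>x. indicator K x *\<^sub>R norm (G x) \<partial>lborel)"
      unfolding set_lebesgue_integral_def by (rule integral_completion) measurable
    also have "\<dots> \<le> (\<integral>x. (\<Sum>b\<in>Basis. indicator (cball 0 r) x *\<^sub>R \<bar>rderiv v b x - rderiv w b x\<bar>) \<partial>lborel)"
    proof (rule integral_mono')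
      show "integrable lborel (\<lambda>x. \<Sum>b\<in>Basis. indicator (cball 0 r) x *\<^sub>R \<bar>rderiv v b x - rderiv w b x\<bar>)"
        by (rule Bochner_Integration.integrable_sum[OF intd])
      fix x
      have "norm (G x) \<le> (\<Sum>b\<in>Basis. \<bar>G x \<bullet> b\<bar>)" by (rule norm_le_l1)
      also have "\<dots> = (\<Sum>b\<in>Basis. \<bar>rderiv v b x - rderiv w b x\<bar>)"
        by (rule sum.cong) (simp_all add: G_def inner_diff_left rgrad_inner)
      finally show "indicator K x *\<^sub>R norm (G x)
          \<le> (\<Sum>b\<in>Basis. indicator (cball 0 r) x *\<^sub>R \<bar>rderiv v b x - rderiv w b x\<bar>)"
        using r(2) by (auto simp: indicator_def subset_iff sum_nonneg)
      show "0 \<le> (\<Sum>b\<in>Basis. indicator (cball 0 r) x *\<^sub>R \<bar>rderiv v b x - rderiv w b x\<bar>)"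
        by (intro sum_nonneg) auto
    qed
    also have "\<dots> = (\<Sum>b\<in>Basis. \<integral>x. indicator (cball 0 r) x *\<^sub>R \<bar>rderiv v b x - rderiv w b x\<bar> \<partial>lborel)"
      by (rule Bochner_Integration.integral_sum[OF intd])
    also have "\<dots> \<le> real DIM('a) * (3 / 4 * (e / A) * c)"
    proof (rule sum_bounded_above)
      fix b :: 'a assume b: "b \<in> Basis"
      have "(\<integral>x. indicator (cball 0 r) x * \<bar>rderiv v b x - rderiv w b x\<bar> \<partial>lborel)
          \<le> (4 * \<epsilon> + 2 * \<eta> / h + M * h) * c"
        unfolding c_def using close r(1) by (intro integral_abs_rderiv_diff_le[OF v w b \<epsilon> h]) auto
      also have "\<dots> \<le> 3 / 4 * (e / A) * c" using small c by (intro mult_right_mono)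
      finally show "(\<integral>x. indicator (cball 0 r) x *\<^sub>R \<bar>rderiv v b x - rderiv w b x\<bar> \<partial>lborel)
          \<le> 3 / 4 * (e / A) * c" by simp
    qed
    finally have "(LINT x:K|lebesgue. \<bar>v x - w x\<bar>) + (LINT x:K|lebesgue. norm (G x))
        \<le> (real DIM('a) + 1) * (3 / 4 * (e / A) * c)"
      using int_value unfolding distrib_right by linarith
    also have "\<dots> = 3 / 4 * (e / A) * (A - 1)" by (simp add: A_def)
    also have "\<dots> < e / A * A"
    proof -
      have "3 / 4 * (e / A) * (A - 1) \<le> 3 / 4 * (e / A) * A"
        using e A by (intro mult_left_mono) auto
      moreover have "3 / 4 * (e / A) * A = 3 / 4 * e" "e / A * A = e" using A by auto
      ultimately show ?thesis using e by linarith
    qed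
    also have "\<dots> = e" using A by simp
    finally show ?thesis using G wv by (auto simp: W11_ball_def W11_loc_def)
  qed
  then show ?thesis using \<eta> by blast
qed (blast intro: zero_less_one)

text \<open>
  On \<open>M\<close>-Lipschitz functions, closeness at the points of a finite net of a ball implies uniform closeness on
  the ball.
\<close>

lemma finite_test_set:
  fixes r :: real
  assumes "0 \<le> M" "0 < \<eta>"
  shows "\<exists>N::'a::euclidean_space set. finite N \<and> (\<forall>u v. M-lipschitz_on UNIV u \<longrightarrow> M-lipschitz_on UNIV v \<longrightarrow>
    (\<forall>y\<in>N. \<bar>v y - u y\<bar> < \<eta> / 2) \<longrightarrow> (\<forall>x\<in>cball 0 r. \<bar>v x - u x\<bar> \<le> (\<eta>::real)))"
proof -
  define e where "e = \<eta> / (4 * (M + 1))"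
  have e: "0 < e" "M * e \<le> \<eta> / 4"
    using assms by (auto simp: e_def field_simps)
  obtain N :: "'a set" where N: "finite N" "cball 0 r \<subseteq> (\<Union>y\<in>N. ball y e)"
    using seq_compact_imp_totally_bounded[of "cball (0::'a) r"] e(1)
    by (meson compact_cball compact_imp_seq_compact)
  have "\<bar>v x - u x\<bar> \<le> \<eta>"
    if u: "M-lipschitz_on UNIV u" and v: "M-lipschitz_on UNIV v"
      and close: "\<forall>y\<in>N. \<bar>v y - u y\<bar> < \<eta> / 2" and x: "x \<in> cball 0 r" for u v and x :: 'a
  proof -
    obtain y where y: "y \<in> N" "dist y x < e" using N(2) x by auto
    have *: "\<bar>k x - k y\<bar> \<le> \<eta> / 4" if k: "M-lipschitz_on UNIV k" for k :: "'a \<Rightarrow> real"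
    proof -
      have "dist (k x) (k y) \<le> M * dist x y" by (rule lipschitz_onD[OF k]) auto
      also have "\<dots> \<le> M * e" using y(2) assms(1) by (intro mult_left_mono) (auto simp: dist_commute)
      finally show ?thesis using e(2) by (simp add: dist_real_def)
    qed
    show ?thesis using *[OF u] *[OF v] bspec[OF close y(1)] by linarith
  qed
  then show ?thesis using N(1) by blast
qed

text \<open>
  Compactness in the topology of pointwise convergence: the set is a closed subset of a product of
  compact intervals.
\<close>

lemma compact_lipschitz_functions:
  assumes "0 \<le> M"
  shows "compact {u :: 'a::euclidean_space \<Rightarrow> real. M-lipschitz_on UNIV u \<and> \<bar>u 0\<bar> \<le> m}"
proof -
  define B where "B = (\<Pi>\<^sub>E x\<in>UNIV. {- (m + M * norm x)..m + M * norm (x::'a)} :: real set)"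
  have "compactin (product_topology (\<lambda>x. euclidean) UNIV) B"
    unfolding B_def by (simp add: compactin_PiE)
  then have B: "compact B" by (simp add: euclidean_product_topology)
  define Q where "Q = {u :: 'a \<Rightarrow> real. M-lipschitz_on UNIV u \<and> \<bar>u 0\<bar> \<le> m}"
  have Q: "Q = {u. (\<forall>x y. \<bar>u x - u y\<bar> \<le> M * dist x y) \<and> \<bar>u 0\<bar> \<le> m}"
    using assms by (auto simp: Q_def lipschitz_on_def dist_real_def)
  have "closed Q" unfolding Q
    by (intro closed_Collect_conj closed_Collect_all closed_Collect_le continuous_intros
        continuous_on_product_coordinates)
  moreover have "Q \<subseteq> B"
  proof
    fix u assume u: "u \<in> Q"
    have "u x \<in> {- (m + M * norm x)..m + M * norm x}" for x
    proof -
      have "\<bar>u x - u 0\<bar> \<le> M * dist x 0" "\<bar>u 0\<bar> \<le> m"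
        using u unfolding Q by blast+
      then show ?thesis by (auto simp: abs_le_iff)
    qed
    then show "u \<in> B" by (simp add: B_def PiE_iff extensional_def)
  qed
  ultimately have "compact (B \<inter> Q)" by (intro compact_Int_closed B)
  with \<open>Q \<subseteq> B\<close> show ?thesis by (simp add: Int_absorb1 Q_def)
qed

context superlinear_convex
begin

lemma compactin_hopf_lax_image:
  assumes t: "0 < t" and M: "0 \<le> M"
  shows "compactin W11_loc_topology (hopf_lax H t ` {u. M-lipschitz_on UNIV u \<and> \<bar>u 0\<bar> \<le> m})"
proof -
  define Q where "Q = {u :: 'a \<Rightarrow> real. M-lipschitz_on UNIV u \<and> \<bar>u 0\<bar> \<le> m}"
  obtain \<delta> where \<delta>: "\<And>u. M-lipschitz_on UNIV u \<Longrightarrow> uniformly_semiconcave \<delta> (hopf_lax H t u)"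
    using hopf_lax_uniformly_semiconcave[OF t M] by blast
  obtain R where R: "\<And>u v r \<eta>. M-lipschitz_on UNIV u \<Longrightarrow> M-lipschitz_on UNIV v \<Longrightarrow>
      \<forall>y\<in>cball 0 (r + R). \<bar>u y - v y\<bar> \<le> \<eta> \<Longrightarrow>
      \<forall>x\<in>cball 0 r. \<bar>hopf_lax H t u x - hopf_lax H t v x\<bar> \<le> \<eta>"
    using hopf_lax_local[OF t M] by blast
  have lip: "M-lipschitz_on UNIV u" if "u \<in> Q" for u using that by (simp add: Q_def)
  have "continuous_map (top_of_set Q) W11_loc_topology (hopf_lax H t)"
    unfolding continuous_map
  proof (intro conjI allI impI)
    show "hopf_lax H t ` topspace (top_of_set Q) \<subseteq> topspace W11_loc_topology"
      using weak_gradient_rgrad[OF hopf_lax_lipschitz[OF t lip] \<delta>[OF lip]]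
      by (auto simp: topspace_W11_loc_topology W11_loc_def)
    fix U :: "('a \<Rightarrow> real) set" assume U: "openin W11_loc_topology U"
    show "openin (top_of_set Q) {u \<in> topspace (top_of_set Q). hopf_lax H t u \<in> U}"
    proof (subst openin_subopen, intro ballI)
      fix u assume "u \<in> {u \<in> topspace (top_of_set Q). hopf_lax H t u \<in> U}"
      then have u: "u \<in> Q" "hopf_lax H t u \<in> U" by auto
      then obtain K e where K: "compact K" "0 < e" "W11_ball K (hopf_lax H t u) e \<subseteq> U"
        using U unfolding openin_W11_loc_topology by blast
      obtain r \<eta> where \<eta>: "0 < \<eta>" and ball: "\<And>v w. M-lipschitz_on UNIV v \<Longrightarrow> uniformly_semiconcave \<delta> v \<Longrightarrow>
          M-lipschitz_on UNIV w \<Longrightarrow> uniformly_semiconcave \<delta> w \<Longrightarrow>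
          \<forall>x\<in>cball 0 r. \<bar>v x - w x\<bar> \<le> \<eta> \<Longrightarrow> v \<in> W11_ball K w e"
        using uniformly_close_in_W11_ball[OF K(1,2) M] by blast
      obtain N :: "'a set" where N: "finite N" "\<And>u v. M-lipschitz_on UNIV u \<Longrightarrow> M-lipschitz_on UNIV v \<Longrightarrow>
          \<forall>y\<in>N. \<bar>v y - u y\<bar> < \<eta> / 2 \<Longrightarrow> \<forall>x\<in>cball 0 (r + R). \<bar>v x - u x\<bar> \<le> \<eta>"
        using finite_test_set[OF M \<eta>, of "r + R"] by blast
      define V where "V = (\<Inter>y\<in>N. {v. \<bar>v y - u y\<bar> < \<eta> / 2})"
      have "open V" unfolding V_def
        by (intro open_INT N(1) ballI open_Collect_less continuous_intros continuous_on_product_coordinates)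
      moreover have "hopf_lax H t v \<in> U" if v: "v \<in> Q" "v \<in> V" for v
      proof -
        have "\<forall>x\<in>cball 0 (r + R). \<bar>v x - u x\<bar> \<le> \<eta>"
          using v(2) by (intro N(2) lip u v) (auto simp: V_def)
        then have "\<forall>x\<in>cball 0 r. \<bar>hopf_lax H t v x - hopf_lax H t u x\<bar> \<le> \<eta>"
          by (intro R lip u v)
        then have "hopf_lax H t v \<in> W11_ball K (hopf_lax H t u) e"
          by (intro ball hopf_lax_lipschitz[OF t] \<delta> lip u v)
        then show ?thesis using K(3) by blast
      qed
      moreover have "u \<in> V" using \<eta> by (simp add: V_def)
      ultimately show "\<exists>T. openin (top_of_set Q) T \<and> u \<in> T \<and>
          T \<subseteq> {u \<in> topspace (top_of_set Q). hopf_lax H t u \<in> U}"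
        using u(1) by (intro exI[of _ "Q \<inter> V"]) (auto intro: openin_open_Int)
    qed
  qed
  moreover have "compactin (top_of_set Q) Q"
    using compact_lipschitz_functions[OF M, of m] by (simp add: compactin_subtopology Q_def)
  ultimately show ?thesis
    using image_compactin unfolding Q_def by blast
qed

end

text \<open>
  The infimum that defines the best Lipschitz constant is attained.
\<close>

lemma lipschitz_on_lip_const:
  assumes "u \<in> Lip" "lip_const u \<le> M"
  shows "M-lipschitz_on UNIV u"
proof (rule lipschitz_onI)
  have ne: "{C. C-lipschitz_on UNIV u} \<noteq> {}" using assms(1) by (auto simp: Lip_def)
  show "0 \<le> M"
    using cInf_greatest[OF ne, of 0] lipschitz_on_nonneg assms(2) unfolding lip_const_def by fastforce
  fix x y :: 'a
  show "dist (u x) (u y) \<le> M * dist x y"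
  proof (cases "x = y")
    case False
    have "dist (u x) (u y) / dist x y \<le> C" if "C-lipschitz_on UNIV u" for C
      using lipschitz_onD[OF that, of x y] False by (simp add: pos_divide_le_eq)
    then have "dist (u x) (u y) / dist x y \<le> lip_const u"
      unfolding lip_const_def by (intro cInf_greatest[OF ne]) auto
    with assms(2) have "dist (u x) (u y) / dist x y \<le> M" by simp
    then show ?thesis using False by (simp add: pos_divide_le_eq)
  qed simp
qed

lemma superlinear_convex_of_assumption_A:
  assumes "assumption_A H"
  shows "superlinear_convex H"
proof
  have "\<And>x. H differentiable (at x)" using assms by (auto simp: assumption_A_def)
  then show "continuous_on UNIV H"
    by (meson continuous_at_imp_continuous_on differentiable_imp_continuous_within)
qed (use assms in \<open>auto simp: assumption_A_def\<close>)

theorem corollary3p3: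
  fixes H :: "'a::euclidean_space \<Rightarrow> real" and T :: real
  assumes "assumption_A H"
    and "assumption_B H"
    and "T > 0"
  shows "(\<forall>u\<in>Lip. hopf_lax H T u \<in> Lip) \<and>
    (\<forall>m>0. \<forall>M>0. relatively_compact_in W11_loc_topology
      (hopf_lax H T ` {u \<in> Lip. \<bar>u 0\<bar> \<le> m \<and> lip_const u \<le> M}))"
proof -
  interpret superlinear_convex H by (rule superlinear_convex_of_assumption_A[OF assms(1)])
  have "hopf_lax H T u \<in> Lip" if "u \<in> Lip" for u
    using that hopf_lax_lipschitz[OF assms(3)] by (auto simp: Lip_def)
  moreover have "relatively_compact_in W11_loc_topology
      (hopf_lax H T ` {u \<in> Lip. \<bar>u 0\<bar> \<le> m \<and> lip_const u \<le> M})" if "0 < M" for m M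
  proof (rule relatively_compact_in_subset[OF regular_space_W11_loc])
    show "compactin W11_loc_topology (hopf_lax H T ` {u. M-lipschitz_on UNIV u \<and> \<bar>u 0\<bar> \<le> m})"
      using that by (intro compactin_hopf_lax_image[OF assms(3)]) simp
  qed (auto intro: lipschitz_on_lip_const)
  ultimately show ?thesis by blast
qed

end
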